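(* If an effectively uniformly recurrent word $x\in\Sigma^\omega$ generates a uniquely ergodic shift $X$ with invariant measure $\mu$, then $x$ admits computable factor frequencies.
   Context: $\Sigma$ is a finite non-empty alphabet; words are indexed from $0$, $x(n)$ is the $n$-th letter and $x(i,j)$ the factor at positions $i,\dots,j-1$. Recurrence: $x$ is recurrent if every factor occurs infinitely often. A return word to a factor $u$ is a word $r$ such that $ru$ is a factor of $x$ containing exactly two occurrences of $u$, one as prefix and one as suffix. A recurrent word is uniformly recurrent if every factor has finitely many return words; $R_x(n)$ is the length of the longest return word to a length-$n$ factor. It is effectively uniformly recurrent if $n\mapsto x(n)$ and $n\mapsto R_x(n)$ are computable. Shifts: $T$ is the shift map on $\Sigma^\omega$ (delete the first letter), with the product topology. The shift generated by $x$ is the closure $X$ of $\{T^nx : n\in\mathbb{N}\}$. An invariant measure on $X$ is a Borel probability measure $\mu$ with $\mu(T^{-1}B)=\mu(B)$ for all Borel $B\subseteq X$; $X$ is uniquely ergodic if it has exactly one invariant measure. Frequencies: $f_x(u)=\lim_{N\to\infty}\frac1N|\{i<N : x(i,i+|u|)=u\}|$. A word admits factor frequencies if this limit exists for every factor $u$ occurring infinitely often in it; the frequencies are computable if moreover there is a Turing machine which, given a factor $u$ and a tolerance $\delta>0$, computes a rational $\rho$ with $|f_x(u)-\rho|<\delta$. *)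

theory Defs
  imports "HOL-Probability.Probability" "HOL-Library.Nat_Bijection" "HOL-Library.Sublist"
begin

section \<open>Turing machines\<close>

text \<open>
  Deterministic machines with finitely many two-way infinite tapes. States and tape symbols are
  initial segments of the naturals; state 0 is initial, symbol 0 is the blank and symbol 1 the
  stroke. A machine halts when no instruction applies, i.e. the transition function returns None.
\<close>

datatype head_move = Go_left | Stay | Go_right

record turing_machine =
  num_tapes :: nat
  num_symbols :: nat
  num_states :: nat
  transition :: "nat \<Rightarrow> nat list \<Rightarrow> (nat \<times> (nat \<times> head_move) list) option"

text \<open>
  Well-formedness closes the finite ranges of states and symbols under the transition function, so
  a run only ever consults a finite table; values outside these ranges are irrelevant.
\<close>

definition turing_machine_wf :: "turing_machine \<Rightarrow> bool" where
  "turing_machine_wf M \<longleftrightarrow>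
     num_tapes M \<ge> 1 \<and> num_symbols M \<ge> 2 \<and> num_states M \<ge> 1 \<and>
     (\<forall>q < num_states M. \<forall>as. length as = num_tapes M \<longrightarrow> set as \<subseteq> {..<num_symbols M} \<longrightarrow>
        (case transition M q as of
           None \<Rightarrow> True
         | Some (q', acts) \<Rightarrow> q' < num_states M \<and> length acts = num_tapes M \<and>
             (\<forall>(b, d) \<in> set acts. b < num_symbols M)))"

text \<open>Tapes are stored relative to the head, which always scans cell 0; moving the head right
  therefore shifts the contents to the left.\<close>

type_synonym tape = "int \<Rightarrow> nat"

fun move_head :: "head_move \<Rightarrow> tape \<Rightarrow> tape" where
  "move_head Go_left t = (\<lambda>i. t (i - 1))"
| "move_head Stay t = t"
| "move_head Go_right t = (\<lambda>i. t (i + 1))"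

fun act_on_tape :: "nat \<times> head_move \<Rightarrow> tape \<Rightarrow> tape" where
  "act_on_tape (b, d) t = move_head d (t(0 := b))"

fun tm_next :: "turing_machine \<Rightarrow> nat \<times> tape list \<Rightarrow> (nat \<times> tape list) option" where
  "tm_next M (q, ts) =
     (case transition M q (map (\<lambda>t. t 0) ts) of
        None \<Rightarrow> None
      | Some (q', acts) \<Rightarrow> Some (q', map2 act_on_tape acts ts))"

abbreviation blank_tape :: tape where
  "blank_tape \<equiv> \<lambda>_. 0"

definition unary_tape :: "nat \<Rightarrow> tape" where
  "unary_tape n = (\<lambda>i. if 0 \<le> i \<and> i < int n then 1 else 0)"

definition tm_input :: "turing_machine \<Rightarrow> nat list \<Rightarrow> tape list" where
  "tm_input M ns = map unary_tape ns @ replicate (num_tapes M - length ns) blank_tape"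

definition tm_output :: "turing_machine \<Rightarrow> nat \<Rightarrow> tape list" where
  "tm_output M r = unary_tape r # replicate (num_tapes M - 1) blank_tape"

text \<open>
  As usual for machines computing number-theoretic functions, the machine must halt in standard
  configuration: the result in unary on the first tape, everything else erased.
\<close>

definition tm_computes :: "turing_machine \<Rightarrow> nat list \<Rightarrow> nat \<Rightarrow> bool" where
  "tm_computes M ns r \<longleftrightarrow>
     length ns \<le> num_tapes M \<and>
     (\<exists>q. (\<lambda>c c'. tm_next M c = Some c')\<^sup>*\<^sup>* (0, tm_input M ns) (q, tm_output M r) \<and>
          tm_next M (q, tm_output M r) = None)"

definition computable :: "(nat \<Rightarrow> nat) \<Rightarrow> bool" where
  "computable f \<longleftrightarrow> (\<exists>M. turing_machine_wf M \<and> (\<forall>n. tm_computes M [n] (f n)))"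


section \<open>Infinite words\<close>

text \<open>An infinite word over the alphabet \<open>'a\<close> is a function \<open>nat \<Rightarrow> 'a\<close>; finite words are
  lists.\<close>

definition subword :: "(nat \<Rightarrow> 'a) \<Rightarrow> nat \<Rightarrow> nat \<Rightarrow> 'a list" where
  "subword x i j = map x [i..<j]"

definition factor :: "(nat \<Rightarrow> 'a) \<Rightarrow> 'a list \<Rightarrow> bool" where
  "factor x u \<longleftrightarrow> (\<exists>i j. i \<le> j \<and> u = subword x i j)"

definition occurs_infinitely_often :: "(nat \<Rightarrow> 'a) \<Rightarrow> 'a list \<Rightarrow> bool" where
  "occurs_infinitely_often x u \<longleftrightarrow> infinite {i. subword x i (i + length u) = u}"

definition recurrent :: "(nat \<Rightarrow> 'a) \<Rightarrow> bool" where
  "recurrent x \<longleftrightarrow> (\<forall>u. factor x u \<longrightarrow> occurs_infinitely_often x u)"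

definition occurrences :: "'a list \<Rightarrow> 'a list \<Rightarrow> nat set" where
  "occurrences u w = {i. i + length u \<le> length w \<and> take (length u) (drop i w) = u}"

definition return_word :: "(nat \<Rightarrow> 'a) \<Rightarrow> 'a list \<Rightarrow> 'a list \<Rightarrow> bool" where
  "return_word x u r \<longleftrightarrow>
     factor x (r @ u) \<and> card (occurrences u (r @ u)) = 2 \<and>
     prefix u (r @ u) \<and> suffix u (r @ u)"

definition uniformly_recurrent :: "(nat \<Rightarrow> 'a) \<Rightarrow> bool" where
  "uniformly_recurrent x \<longleftrightarrow>
     recurrent x \<and> (\<forall>u. factor x u \<longrightarrow> finite {r. return_word x u r})"

text \<open>The maximum is over a finite non-empty set whenever \<open>x\<close> is a uniformly recurrent word over
  a finite alphabet.\<close>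

definition longest_return :: "(nat \<Rightarrow> 'a) \<Rightarrow> nat \<Rightarrow> nat" where
  "longest_return x n =
     Max {length r | r. \<exists>u. factor x u \<and> length u = n \<and> return_word x u r}"

text \<open>Letters are numbered by the injection \<^const>\<open>to_nat\<close>; as the alphabet is finite, any two
  numberings are computable from each other.\<close>

definition effectively_uniformly_recurrent :: "(nat \<Rightarrow> 'a::finite) \<Rightarrow> bool" where
  "effectively_uniformly_recurrent x \<longleftrightarrow>
     uniformly_recurrent x \<and> computable (\<lambda>n. to_nat (x n)) \<and> computable (longest_return x)"


section \<open>Shifts and invariant measures\<close>

definition shift_map :: "(nat \<Rightarrow> 'a) \<Rightarrow> nat \<Rightarrow> 'a" where
  "shift_map y = (\<lambda>n. y (Suc n))"

text \<open>With \<open>'a\<close> discrete, the topology on \<open>nat \<Rightarrow> 'a\<close> is the product topology.\<close>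

definition generated_shift ::
    "(nat \<Rightarrow> 'a::discrete_topology) \<Rightarrow> (nat \<Rightarrow> 'a) set" where
  "generated_shift x = closure {(shift_map ^^ n) x | n. True}"

definition invariant_measure ::
    "(nat \<Rightarrow> 'a::discrete_topology) set \<Rightarrow> (nat \<Rightarrow> 'a) measure \<Rightarrow> bool" where
  "invariant_measure X \<mu> \<longleftrightarrow>
     space \<mu> = X \<and> sets \<mu> = sets (restrict_space borel X) \<and> prob_space \<mu> \<and>
     (\<forall>B \<in> sets \<mu>. emeasure \<mu> (shift_map -` B \<inter> X) = emeasure \<mu> B)"

definition uniquely_ergodic :: "(nat \<Rightarrow> 'a::discrete_topology) set \<Rightarrow> bool" where
  "uniquely_ergodic X \<longleftrightarrow> (\<exists>!\<mu>. invariant_measure X \<mu>)"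


section \<open>Factor frequencies\<close>

definition prefix_frequency :: "(nat \<Rightarrow> 'a) \<Rightarrow> 'a list \<Rightarrow> nat \<Rightarrow> real" where
  "prefix_frequency x u N = real (card {i. i < N \<and> subword x i (i + length u) = u}) / real N"

definition factor_frequency :: "(nat \<Rightarrow> 'a) \<Rightarrow> 'a list \<Rightarrow> real" where
  "factor_frequency x u = lim (prefix_frequency x u)"

definition admits_factor_frequencies :: "(nat \<Rightarrow> 'a) \<Rightarrow> bool" where
  "admits_factor_frequencies x \<longleftrightarrow>
     (\<forall>u. factor x u \<and> occurs_infinitely_often x u \<longrightarrow> convergent (prefix_frequency x u))"

text \<open>A single machine serves all factors and tolerances. Its inputs are a code of the factor and a
  code of a positive rational tolerance, its output is a code of a rational, where words are coded
  by \<^const>\<open>list_encode\<close> and rationals by the surjective numbering \<^const>\<open>nat_to_rat_surj\<close>.\<close>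

definition admits_computable_factor_frequencies :: "(nat \<Rightarrow> 'a::finite) \<Rightarrow> bool" where
  "admits_computable_factor_frequencies x \<longleftrightarrow>
     admits_factor_frequencies x \<and>
     (\<exists>M. turing_machine_wf M \<and>
        (\<forall>u d. factor x u \<and> occurs_infinitely_often x u \<and> nat_to_rat_surj d > 0 \<longrightarrow>
           (\<exists>r. tm_computes M [list_encode (map to_nat u), d] r \<and>
                \<bar>factor_frequency x u - of_rat (nat_to_rat_surj r)\<bar>
                  < of_rat (nat_to_rat_surj d))))"

end

theory Submission
  imports Defs
begin

text \<open>
  Unique ergodicity makes the frequency of a factor uniform: if windows of growing length deviated
  from \<open>\<mu>\<close>, then a limit of the corresponding empirical distributions (taken simultaneously on all
  sets by Tychonoff's theorem, and countably additive on clopen sets by compactness) would be a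
  second invariant measure. To approximate the frequency of \<open>u\<close> it therefore suffices to search for
  a window length \<open>N\<close> such that the number of occurrences of \<open>u\<close> varies by less than \<open>\<delta> N\<close> over all
  windows. This is decidable, since by the bound on return words every factor of length \<open>n\<close>
  already occurs at a position below \<open>R\<^sub>x(n)\<close>. The search is turned into a Turing machine by
  compiling a small language of counter programs, with computable functions as subroutines, in which
  each register is a tape in unary.
\<close>

section \<open>Counter programs and their compilation to Turing machines\<close>

text \<open>Unique ergodicity gives convergence without a rate, so no sufficient window length can
  be computed in advance. The stopping test makes up for this by certifying itself: long windows are
  concatenations of windows of length \<open>N\<close>, so as soon as all windows of length
  \<open>N\<close> have nearly the same count, the frequency is close to that count over
  \<open>N\<close>. Beyond the existence of the limits, uniform convergence serves only to make the
  search terminate. Convergence along prefixes would not suffice for this, because the test inspects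
  windows at every position.

  On the machine side, the standard halting configuration is what makes subroutines possible: a
  called machine leaves its result in a register, its head in place and its other tapes blank, so
  every function once shown computable becomes a single instruction. The final machine receives only
  a code of \<open>u\<close>; it therefore also searches for an occurrence of \<open>u\<close>,
  which supplies the length.\<close>

datatype com = Inc nat | Dec nat | Seq com com (infixr ";;" 60) | While nat com | Call "nat \<Rightarrow> nat" nat

inductive big_step :: "com \<Rightarrow> (nat \<Rightarrow> nat) \<Rightarrow> (nat \<Rightarrow> nat) \<Rightarrow> bool" where
  Inc: "big_step (Inc r) s (s(r := Suc (s r)))"
| Dec: "big_step (Dec r) s (s(r := s r - 1))"
| Seq: "big_step c s t \<Longrightarrow> big_step d t u \<Longrightarrow> big_step (c ;; d) s u"
| WhileFalse: "s r = 0 \<Longrightarrow> big_step (While r c) s s"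
| WhileTrue: "s r \<noteq> 0 \<Longrightarrow> big_step c s t \<Longrightarrow> big_step (While r c) t u \<Longrightarrow> big_step (While r c) s u"
| Call: "big_step (Call f r) s (s(r := f (s r)))"

text \<open>A fragment \<open>(n, \<delta>)\<close> has the states \<open>{..<n}\<close>, is entered in state \<open>0\<close> and left by moving to
  state \<open>n\<close>, where \<open>\<delta>\<close> is not consulted any more.\<close>

type_synonym fragment = "nat \<times> (nat \<Rightarrow> nat list \<Rightarrow> nat \<times> (nat \<Rightarrow> nat \<times> head_move))"

definition idle :: "nat list \<Rightarrow> nat \<Rightarrow> nat \<times> head_move" where
  "idle as = (\<lambda>i. (as ! i, Stay))"

definition machine_for :: "(nat \<Rightarrow> nat) \<Rightarrow> turing_machine" where
  "machine_for f = (SOME M. turing_machine_wf M \<and> (\<forall>n. tm_computes M [n] (f n)))"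

text \<open>Tapes below \<open>K\<close> are registers, the others scratch tapes that are blank between calls. A called
  machine works on the register \<open>r\<close> as its tape \<open>0\<close> and on the first scratch tapes.\<close>

definition sub_tape :: "nat \<Rightarrow> nat \<Rightarrow> nat \<Rightarrow> nat" where
  "sub_tape K r j = (if j = 0 then r else K + j - 1)"

text \<open>The host alphabet may be larger than that of \<open>M\<close>, and well-formedness says
  nothing about \<open>M\<close> on foreign symbols; the guard sends such readings to the exit.
  Simulated runs never trigger it, by \<open>legal_config\<close>.\<close>

definition call_fragment :: "nat \<Rightarrow> turing_machine \<Rightarrow> nat \<Rightarrow> fragment" where
  "call_fragment K M r = (num_states M, \<lambda>q as.
     let bs = map (\<lambda>j. as ! sub_tape K r j) [0..<num_tapes M] in
     if set bs \<subseteq> {..<num_symbols M} then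
       (case transition M q bs of
          None \<Rightarrow> (num_states M, idle as)
        | Some (q', acts) \<Rightarrow> (q', \<lambda>i. if i = r then acts ! 0
            else if K \<le> i \<and> i - K + 1 < num_tapes M then acts ! (i - K + 1) else idle as i))
     else (num_states M, idle as))"

text \<open>In the loop, reduction modulo the number of states redirects the exit of the body, which is
  renamed like its other states by \<^const>\<open>Suc\<close>, to the test in state \<open>0\<close>.\<close>

primrec compile :: "nat \<Rightarrow> com \<Rightarrow> fragment" where
  "compile K (Inc r) = (2, \<lambda>q as. if q = 0 then (1, (idle as)(r := (as ! r, Go_left)))
                               else (2, (idle as)(r := (1, Stay))))"
| "compile K (Dec r) = (1, \<lambda>q as. (1, if as ! r = 0 then idle as else (idle as)(r := (0, Go_right))))"
| "compile K (c ;; d) = (fst (compile K c) + fst (compile K d), \<lambda>q as.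
     if q < fst (compile K c) then snd (compile K c) q as
     else apfst ((+) (fst (compile K c))) (snd (compile K d) (q - fst (compile K c)) as))"
| "compile K (While r c) = (Suc (fst (compile K c)), \<lambda>q as.
     if q = 0 then (if as ! r = 0 then Suc (fst (compile K c)) else 1 mod Suc (fst (compile K c)), idle as)
     else apfst (\<lambda>q'. Suc q' mod Suc (fst (compile K c))) (snd (compile K c) (q - 1) as))"
| "compile K (Call f r) = call_fragment K (machine_for f) r"

definition fragment_wf :: "nat \<Rightarrow> nat \<Rightarrow> fragment \<Rightarrow> bool" where
  "fragment_wf T S P \<longleftrightarrow> 1 \<le> fst P \<and>
     (\<forall>q < fst P. \<forall>as. length as = T \<longrightarrow> set as \<subseteq> {..<S} \<longrightarrow>
        fst (snd P q as) \<le> fst P \<and> (\<forall>i<T. fst (snd (snd P q as) i) < S))"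

definition fragment_step :: "nat \<Rightarrow> fragment \<Rightarrow> nat \<times> tape list \<Rightarrow> nat \<times> tape list \<Rightarrow> bool" where
  "fragment_step T P = (\<lambda>(q, ts) (q', ts').
     q < fst P \<and> length ts = T \<and>
     (let (p, acts) = snd P q (map (\<lambda>t. t 0) ts) in
      q' = p \<and> ts' = map (\<lambda>i. act_on_tape (acts i) (ts ! i)) [0..<T]))"

definition fragment_machine :: "nat \<Rightarrow> nat \<Rightarrow> fragment \<Rightarrow> turing_machine" where
  "fragment_machine T S P = \<lparr>num_tapes = T, num_symbols = S, num_states = Suc (fst P),
     transition = (\<lambda>q as. if q < fst P
       then Some (fst (snd P q as), map (snd (snd P q as)) [0..<T]) else None)\<rparr>"

definition registers :: "nat \<Rightarrow> (nat \<Rightarrow> nat) \<Rightarrow> tape list" where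
  "registers T s = map (\<lambda>i. unary_tape (s i)) [0..<T]"

text \<open>\<open>K\<close> bounds the registers, \<open>L\<close> the scratch tapes and
  \<open>S\<close> the alphabet. A called machine has its tape 0 in a register, hence
  \<open>Suc L\<close>.\<close>

primrec fits :: "nat \<Rightarrow> nat \<Rightarrow> nat \<Rightarrow> com \<Rightarrow> bool" where
  "fits K L S (Inc r) = (r < K)"
| "fits K L S (Dec r) = (r < K)"
| "fits K L S (c ;; d) = (fits K L S c \<and> fits K L S d)"
| "fits K L S (While r c) = (r < K \<and> fits K L S c)"
| "fits K L S (Call f r) = (r < K \<and> num_tapes (machine_for f) \<le> Suc L \<and> num_symbols (machine_for f) \<le> S)"

primrec calls_computable :: "com \<Rightarrow> bool" where
  "calls_computable (Inc r) = True"
| "calls_computable (Dec r) = True"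
| "calls_computable (c ;; d) = (calls_computable c \<and> calls_computable d)"
| "calls_computable (While r c) = calls_computable c"
| "calls_computable (Call f r) = computable f"

lemma unary_tape_0 [simp]: "unary_tape n 0 = (if n = 0 then 0 else 1)"
  by (simp add: unary_tape_def)

lemma unary_tape_zero: "unary_tape 0 = blank_tape"
  by (auto simp: unary_tape_def)

lemma act_idle [simp]: "length ts = T \<Longrightarrow> i < T \<Longrightarrow> act_on_tape (idle (map (\<lambda>t. t 0) ts) i) (ts ! i) = ts ! i"
  by (simp add: idle_def)

lemma machine_for:
  assumes "computable f"
  shows "turing_machine_wf (machine_for f)" "tm_computes (machine_for f) [n] (f n)"
  using someI_ex[OF assms[unfolded computable_def]] unfolding machine_for_def by auto

lemma fragment_stepI:
  assumes "q < fst P" "length ts = T" "snd P q (map (\<lambda>t. t 0) ts) = (q', acts)"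
    "ts' = map (\<lambda>i. act_on_tape (acts i) (ts ! i)) [0..<T]"
  shows "fragment_step T P (q, ts) (q', ts')"
  using assms by (simp add: fragment_step_def)

text \<open>Sequencing and looping contain their parts with renamed states. Only states in which the
  part is still running must commute with the renaming, so its exit may become any state, even the
  loop test.\<close>

lemma fragment_step_rename:
  assumes "(fragment_step T P)\<^sup>*\<^sup>* (q, ts) (q', ts')"
    and "\<And>q as. q < fst P \<Longrightarrow> \<phi> q < fst Q \<and> snd Q (\<phi> q) as = apfst \<phi> (snd P q as)"
  shows "(fragment_step T Q)\<^sup>*\<^sup>* (\<phi> q, ts) (\<phi> q', ts')"
  using assms(1)
proof (induction "(q', ts')" arbitrary: q' ts' rule: rtranclp_induct)
  case base
  then show ?case by simp
next
  case (step y)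
  obtain p us where y: "y = (p, us)" by force
  have "fragment_step T Q (\<phi> p, us) (\<phi> q', ts')"
    using step(2) assms(2)[of p "map (\<lambda>t. t 0) us"] unfolding y
    by (auto simp: fragment_step_def split: prod.splits)
  with step(3)[OF y] show ?case by (rule rtranclp.rtrancl_into_rtrancl)
qed

lemma fits_mono: "fits K L S c \<Longrightarrow> K \<le> K' \<Longrightarrow> L \<le> L' \<Longrightarrow> S \<le> S' \<Longrightarrow> fits K' L' S' c"
  by (induction c) auto

lemma ex_fits: "\<exists>K L S. fits K L S c"
proof (induction c)
  case (Seq c d)
  then obtain K L S K' L' S' where "fits K L S c" "fits K' L' S' d" by blast
  then have "fits (max K K') (max L L') (max S S') (c ;; d)"
    by (auto intro: fits_mono)
  then show ?case by blast
next
  case (While r c)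
  then obtain K L S where "fits K L S c" by blast
  then have "fits (max K (Suc r)) L S (While r c)"
    by (auto intro: fits_mono)
  then show ?case by blast
next
  case (Call f r)
  have "fits (Suc r) (num_tapes (machine_for f)) (num_symbols (machine_for f)) (Call f r)" by simp
  then show ?case by blast
qed (auto intro: lessI)

lemma nth_less: "length as = T \<Longrightarrow> set as \<subseteq> {..<S} \<Longrightarrow> i < T \<Longrightarrow> as ! i < (S::nat)"
  using nth_mem by fastforce

lemma compile_wf:
  assumes "fits K L S c" "calls_computable c" "2 \<le> S"
  shows "fragment_wf (K + L) S (compile K c)"
  using assms
proof (induction c)
  case (Inc r)
  then show ?case by (auto simp: fragment_wf_def idle_def nth_less)
next
  case (Dec r)
  then show ?case by (auto simp: fragment_wf_def idle_def nth_less)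
next
  case (Seq c d)
  then have IH: "fragment_wf (K + L) S (compile K c)" "fragment_wf (K + L) S (compile K d)" by auto
  then show ?case
    by (fastforce simp: fragment_wf_def)
next
  case (While r c)
  then have IH: "fragment_wf (K + L) S (compile K c)" by auto
  then show ?case
    by (auto simp: fragment_wf_def idle_def nth_less intro!: less_imp_le[OF mod_less_divisor])
next
  case (Call f r)
  define M where "M = machine_for f"
  have M: "turing_machine_wf M" "num_tapes M \<le> Suc L" "num_symbols M \<le> S" "r < K"
    using Call machine_for(1) by (auto simp: M_def)
  show ?case
    unfolding fragment_wf_def compile.simps M_def[symmetric]
  proof (intro conjI allI impI)
    show "1 \<le> fst (call_fragment K M r)"
      using M by (simp add: call_fragment_def turing_machine_wf_def)
    fix q as
    assume q: "q < fst (call_fragment K M r)" and as: "length as = K + L" "set as \<subseteq> {..<S}"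
    define bs where "bs = map (\<lambda>j. as ! sub_tape K r j) [0..<num_tapes M]"
    have idle: "fst (idle as i) < S" if "i < K + L" for i
      using as that by (auto simp: idle_def nth_less)
    have eq: "snd (call_fragment K M r) q as = (if set bs \<subseteq> {..<num_symbols M} then
       (case transition M q bs of
          None \<Rightarrow> (num_states M, idle as)
        | Some (q', acts) \<Rightarrow> (q', \<lambda>i. if i = r then acts ! 0
            else if K \<le> i \<and> i - K + 1 < num_tapes M then acts ! (i - K + 1) else idle as i))
     else (num_states M, idle as))"
      by (simp add: call_fragment_def bs_def Let_def)
    have n: "fst (call_fragment K M r) = num_states M"
      by (simp add: call_fragment_def)
    have "fst (snd (call_fragment K M r) q as) \<le> num_states M \<and>
       (\<forall>i<K + L. fst (snd (snd (call_fragment K M r) q as) i) < S)"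
    proof (cases "set bs \<subseteq> {..<num_symbols M} \<and> transition M q bs \<noteq> None")
      case False
      then show ?thesis using idle unfolding eq by (auto split: option.splits)
    next
      case True
      then obtain q' acts where tr: "transition M q bs = Some (q', acts)" by auto
      have "length bs = num_tapes M" by (simp add: bs_def)
      with M(1) q[unfolded n] True tr
      have w: "q' < num_states M" "length acts = num_tapes M" "\<forall>(b, d) \<in> set acts. b < num_symbols M" "num_tapes M \<ge> 1"
        unfolding turing_machine_wf_def by fastforce+
      have a: "fst (acts ! k) < S" if "k < num_tapes M" for k
        using w that M(3) nth_mem[of k acts] by fastforce
      show ?thesis unfolding eq using True tr w a idle by auto
    qed
    then show "fst (snd (call_fragment K M r) q as) \<le> fst (call_fragment K M r)"
      "\<And>i. i < K + L \<Longrightarrow> fst (snd (snd (call_fragment K M r) q as) i) < S"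
      unfolding n by auto
  qed
qed


section \<open>Simulation of a called machine on the tapes of its host\<close>

definition embed_tapes :: "nat \<Rightarrow> nat \<Rightarrow> nat \<Rightarrow> (nat \<Rightarrow> nat) \<Rightarrow> tape list \<Rightarrow> tape list" where
  "embed_tapes K L r s ts = map (\<lambda>i. if i = r then ts ! 0 else if i < K then unary_tape (s i)
     else if i - K + 1 < length ts then ts ! (i - K + 1) else blank_tape) [0..<K + L]"

text \<open>The invariant of a simulated run. All cells are constrained, not only the scanned ones,
  because the head may reach any of them later.\<close>

definition legal_config :: "turing_machine \<Rightarrow> nat \<times> tape list \<Rightarrow> bool" where
  "legal_config M c \<longleftrightarrow> fst c < num_states M \<and> length (snd c) = num_tapes M \<and>
     (\<forall>t \<in> set (snd c). \<forall>z. t z < num_symbols M)"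

lemma act_on_tape_less: "(\<forall>z. t z < (S::nat)) \<Longrightarrow> b < S \<Longrightarrow> act_on_tape (b, d) t z < S"
  by (cases d) auto

context
  fixes M :: turing_machine and K L r :: nat
  assumes M: "turing_machine_wf M" and L: "num_tapes M \<le> Suc L" and r: "r < K"
begin

lemma read_embed_tapes:
  assumes "length ts = num_tapes M"
  shows "map (\<lambda>j. map (\<lambda>t. t 0) (embed_tapes K L r s ts) ! sub_tape K r j) [0..<num_tapes M] = map (\<lambda>t. t 0) ts"
proof (rule nth_equalityI)
  fix j assume "j < length (map (\<lambda>j. map (\<lambda>t. t 0) (embed_tapes K L r s ts) ! sub_tape K r j) [0..<num_tapes M])"
  then have "j < num_tapes M" by simp
  moreover have "j \<noteq> 0 \<Longrightarrow> Suc (K + j - Suc 0 - K) = j" by linarith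
  ultimately show "map (\<lambda>j. map (\<lambda>t. t 0) (embed_tapes K L r s ts) ! sub_tape K r j) [0..<num_tapes M] ! j =
      map (\<lambda>t. t 0) ts ! j"
    using L r assms by (auto simp: sub_tape_def embed_tapes_def)
qed (use assms in simp)

lemma call_fragment_halt:
  assumes "legal_config M (q, ts)" "tm_next M (q, ts) = None"
  shows "fragment_step (K + L) (call_fragment K M r) (q, embed_tapes K L r s ts)
           (num_states M, embed_tapes K L r s ts)"
proof -
  have l: "length ts = num_tapes M" "set (map (\<lambda>t. t 0) ts) \<subseteq> {..<num_symbols M}" "q < num_states M"
    using assms(1) by (auto simp: legal_config_def)
  have tr: "transition M q (map (\<lambda>t. t 0) ts) = None"
    using assms(2) by (auto split: option.splits)
  have len: "length (embed_tapes K L r s ts) = K + L" by (simp add: embed_tapes_def)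
  have eq: "snd (call_fragment K M r) q (map (\<lambda>t. t 0) (embed_tapes K L r s ts)) =
      (num_states M, idle (map (\<lambda>t. t 0) (embed_tapes K L r s ts)))"
    using l(2) tr by (simp add: call_fragment_def read_embed_tapes[OF l(1)] del: set_map)
  show ?thesis
    by (rule fragment_stepI[OF _ len eq]) (use l(3) in \<open>simp add: call_fragment_def\<close>, rule nth_equalityI, simp_all add: len)
qed

lemma call_fragment_step:
  assumes "legal_config M (q, ts)" "tm_next M (q, ts) = Some (q', ts')"
  shows "legal_config M (q', ts')"
    and "fragment_step (K + L) (call_fragment K M r) (q, embed_tapes K L r s ts)
           (q', embed_tapes K L r s ts')"
proof -
  have l: "length ts = num_tapes M" "set (map (\<lambda>t. t 0) ts) \<subseteq> {..<num_symbols M}" "q < num_states M"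
    using assms(1) by (auto simp: legal_config_def)
  obtain acts where tr: "transition M q (map (\<lambda>t. t 0) ts) = Some (q', acts)"
    and ts': "ts' = map2 act_on_tape acts ts"
    using assms(2) by (auto split: option.splits)
  have "case transition M q (map (\<lambda>t. t 0) ts) of None \<Rightarrow> True
         | Some (q', acts) \<Rightarrow> q' < num_states M \<and> length acts = num_tapes M \<and>
             (\<forall>(b, d) \<in> set acts. b < num_symbols M)"
    using M l by (simp add: turing_machine_wf_def)
  then have w: "q' < num_states M" "length acts = num_tapes M" "\<forall>(b, d) \<in> set acts. b < num_symbols M"
    by (simp_all add: tr)
  have M1: "0 < num_tapes M" using M by (simp add: turing_machine_wf_def)
  have l': "length ts' = num_tapes M" using w l by (simp add: ts')
  have "t z < num_symbols M" if "t \<in> set ts'" for t z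
  proof -
    from that obtain i where i: "i < num_tapes M" "t = act_on_tape (acts ! i) (ts ! i)"
      using w(2) l(1) by (auto simp: ts' in_set_conv_nth)
    obtain b d where bd: "acts ! i = (b, d)" by force
    then have "(b, d) \<in> set acts" using i(1) w(2) nth_mem[of i acts] by simp
    then have "b < num_symbols M" using w(3) by auto
    moreover have "\<forall>z. (ts ! i) z < num_symbols M"
      using assms(1) i(1) by (auto simp: legal_config_def)
    ultimately show ?thesis unfolding i(2) bd by (intro act_on_tape_less)
  qed
  with w(1) l' show "legal_config M (q', ts')" by (auto simp: legal_config_def)
  let ?E = "embed_tapes K L r s"
  have len: "length (?E us) = K + L" for us by (simp add: embed_tapes_def)
  let ?as = "map (\<lambda>t. t 0) (?E ts)"
  have eq: "snd (call_fragment K M r) q ?as =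
      (q', \<lambda>i. if i = r then acts ! 0
            else if K \<le> i \<and> i - K + 1 < num_tapes M then acts ! (i - K + 1) else idle ?as i)"
    using l(2) tr by (simp add: call_fragment_def read_embed_tapes[OF l(1)] del: set_map)
  show "fragment_step (K + L) (call_fragment K M r) (q, ?E ts) (q', ?E ts')"
  proof (rule fragment_stepI[OF _ len eq])
    show "q < fst (call_fragment K M r)" using l(3) by (simp add: call_fragment_def)
    show "?E ts' = map (\<lambda>i. act_on_tape (if i = r then acts ! 0
        else if K \<le> i \<and> i - K + 1 < num_tapes M then acts ! (i - K + 1) else idle ?as i) (?E ts ! i)) [0..<K + L]"
      (is "_ = ?R")
    proof (rule nth_equalityI)
      fix i assume "i < length (?E ts')"
      then have i: "i < K + L" by (simp add: len)
      have "idle ?as i = ((?E ts ! i) 0, Stay)" using i by (simp add: idle_def len)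
      then show "?E ts' ! i = ?R ! i"
        using i r l(1) l' w(2) M1 by (auto simp: embed_tapes_def ts')
    qed (simp add: len)
  qed
qed

lemma call_fragment_steps:
  assumes "(\<lambda>c c'. tm_next M c = Some c')\<^sup>*\<^sup>* (q, ts) (q', ts')" "legal_config M (q, ts)"
  shows "legal_config M (q', ts') \<and> (fragment_step (K + L) (call_fragment K M r))\<^sup>*\<^sup>*
           (q, embed_tapes K L r s ts) (q', embed_tapes K L r s ts')"
  using assms(1)
proof (induction "(q', ts')" arbitrary: q' ts' rule: rtranclp_induct)
  case base
  then show ?case using assms(2) by simp
next
  case (step y)
  obtain p us where y: "y = (p, us)" by force
  from step(3)[OF y] have "legal_config M (p, us)"
    "(fragment_step (K + L) (call_fragment K M r))\<^sup>*\<^sup>* (q, embed_tapes K L r s ts) (p, embed_tapes K L r s us)"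
    by auto
  then show ?case
    using call_fragment_step(1)[of p us q' ts'] call_fragment_step(2)[of p us q' ts' s] step(2) unfolding y
    by (meson rtranclp.rtrancl_into_rtrancl)
qed

text \<open>The input and output conventions of \<open>tm_computes\<close> are exactly what turns
  the embedded first and last configurations into register contents with blank scratch
  tapes.\<close>

lemma call_fragment_correct:
  assumes "tm_computes M [s r] m" "\<forall>i\<ge>K. s i = 0"
  shows "(fragment_step (K + L) (call_fragment K M r))\<^sup>*\<^sup>* (0, registers (K + L) s)
           (num_states M, registers (K + L) (s(r := m)))"
proof -
  from assms(1) obtain q where
    q: "(\<lambda>c c'. tm_next M c = Some c')\<^sup>*\<^sup>* (0, tm_input M [s r]) (q, tm_output M m)"
       "tm_next M (q, tm_output M m) = None"
    by (auto simp: tm_computes_def)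
  have w: "0 < num_states M" "1 < num_symbols M" "0 < num_tapes M"
    using M by (auto simp: turing_machine_wf_def)
  then have "legal_config M (0, tm_input M [s r])"
    by (auto simp: legal_config_def tm_input_def unary_tape_def)
  note * = call_fragment_steps[OF q(1) this, of s]
  have "(fragment_step (K + L) (call_fragment K M r))\<^sup>*\<^sup>*
     (0, embed_tapes K L r s (tm_input M [s r])) (num_states M, embed_tapes K L r s (tm_output M m))"
    using * call_fragment_halt[OF _ q(2), of s] by (meson rtranclp.rtrancl_into_rtrancl)
  moreover have "embed_tapes K L r s (tm_input M [s r]) = registers (K + L) s"
    using assms(2) w(3) by (auto simp: embed_tapes_def tm_input_def registers_def unary_tape_zero)
  moreover have "embed_tapes K L r s (tm_output M m) = registers (K + L) (s(r := m))"
    using assms(2) w(3) by (auto simp: embed_tapes_def tm_output_def registers_def unary_tape_zero)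
  ultimately show ?thesis by simp
qed

end

lemma length_registers [simp]: "length (registers T s) = T"
  by (simp add: registers_def)

lemma nth_registers [simp]: "i < T \<Longrightarrow> registers T s ! i = unary_tape (s i)"
  by (simp add: registers_def)

lemma map_idle_registers: "map (\<lambda>i. act_on_tape (idle (map (\<lambda>t. t 0) (registers T s)) i) (registers T s ! i)) [0..<T] = registers T s"
  by (rule nth_equalityI) (auto simp: idle_def)

text \<open>Vanishing of the state from \<open>K\<close> on expresses that the scratch tapes are
  blank; it is carried along because each call relies on it.\<close>

lemma compile_correct:
  assumes "big_step c s t" "fits K L S c" "calls_computable c" "\<forall>i\<ge>K. s i = 0"
  shows "(\<forall>i\<ge>K. t i = 0) \<and> (fragment_step (K + L) (compile K c))\<^sup>*\<^sup>*
           (0, registers (K + L) s) (fst (compile K c), registers (K + L) t)"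
  using assms
proof (induction rule: big_step.induct)
  case (Inc r s)
  define us where "us = (registers (K + L) s)[r := (\<lambda>i. unary_tape (s r) (i - 1))]"
  have r: "r < K + L" using Inc by simp
  have "fragment_step (K + L) (compile K (Inc r)) (0, registers (K + L) s) (1, us)"
    using r by (auto simp: fragment_step_def us_def registers_def idle_def intro!: nth_equalityI)
  \<comment> \<open>The head rests on the first cell of the unary block, so a register grows and
    shrinks at its left end.\<close>
  moreover have u: "unary_tape (Suc n) = (\<lambda>i. unary_tape n (i - 1))(0 := Suc 0)" for n
    by (auto simp: unary_tape_def)
  have "fragment_step (K + L) (compile K (Inc r)) (1, us) (2, registers (K + L) (s(r := Suc (s r))))"
    using r by (auto simp: fragment_step_def us_def registers_def idle_def u nth_list_update intro!: nth_equalityI)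
  ultimately have "(fragment_step (K + L) (compile K (Inc r)))\<^sup>*\<^sup>* (0, registers (K + L) s) (2, registers (K + L) (s(r := Suc (s r))))"
    by (meson converse_rtranclp_into_rtranclp r_into_rtranclp)
  moreover have "\<forall>i\<ge>K. (s(r := Suc (s r))) i = 0" using Inc by simp
  ultimately show ?case by (simp del: fun_upd_apply)
next
  case (Dec r s)
  have r: "r < K + L" using Dec by simp
  have u: "(\<lambda>i. ((unary_tape n)(0 := 0)) (i + 1)) = unary_tape (n - Suc 0)" for n
    by (rule ext, cases n) (auto simp: unary_tape_def)
  have "fragment_step (K + L) (compile K (Dec r)) (0, registers (K + L) s) (1, registers (K + L) (s(r := s r - 1)))"
    using r u[of "s r"] by (auto simp: fragment_step_def registers_def idle_def intro!: nth_equalityI)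
  moreover have "\<forall>i\<ge>K. (s(r := s r - 1)) i = 0" using Dec by simp
  ultimately show ?case by (simp add: r_into_rtranclp del: fun_upd_apply)
next
  case (Seq c s t d u)
  define m where "m = fst (compile K c)"
  have "(fragment_step (K + L) (compile K (c ;; d)))\<^sup>*\<^sup>*
           (0, registers (K + L) s) (m, registers (K + L) t)"
    unfolding m_def
    by (rule fragment_step_rename[where \<phi>="\<lambda>q. q" and P="compile K c"]) (use Seq in \<open>auto simp: apfst_def map_prod_def\<close>)
  moreover have "(fragment_step (K + L) (compile K (c ;; d)))\<^sup>*\<^sup>*
           (m + 0, registers (K + L) t) (m + fst (compile K d), registers (K + L) u)"
    by (rule fragment_step_rename[where P="compile K d"]) (use Seq in \<open>auto simp: m_def\<close>)
  ultimately have "(fragment_step (K + L) (compile K (c ;; d)))\<^sup>*\<^sup>*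
           (0, registers (K + L) s) (fst (compile K (c ;; d)), registers (K + L) u)"
    by (simp add: m_def)
  moreover have "\<forall>i\<ge>K. u i = 0" using Seq by simp
  ultimately show ?case by blast
next
  case (WhileFalse s r c)
  have r: "r < K + L" using WhileFalse by simp
  have "fragment_step (K + L) (compile K (While r c)) (0, registers (K + L) s) (fst (compile K (While r c)), registers (K + L) s)"
    by (rule fragment_stepI[where acts="idle (map (\<lambda>t. t 0) (registers (K + L) s))"])
       (use r WhileFalse(1) in \<open>simp_all add: map_idle_registers\<close>)
  then show ?case using WhileFalse by (simp add: r_into_rtranclp del: compile.simps)
next
  case (WhileTrue s r c t u)
  define m where "m = Suc (fst (compile K c))"
  have r: "r < K + L" using WhileTrue by simp
  have "fragment_step (K + L) (compile K (While r c)) (0, registers (K + L) s) (Suc 0 mod m, registers (K + L) s)"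
    by (rule fragment_stepI[where acts="idle (map (\<lambda>t. t 0) (registers (K + L) s))"])
       (use r WhileTrue(1) in \<open>simp_all add: m_def map_idle_registers\<close>)
  moreover have "(fragment_step (K + L) (compile K (While r c)))\<^sup>*\<^sup>*
           (Suc 0 mod m, registers (K + L) s) (Suc (fst (compile K c)) mod m, registers (K + L) t)"
    by (rule fragment_step_rename[where P="compile K c"]) (use WhileTrue in \<open>auto simp: m_def\<close>)
  moreover have "Suc (fst (compile K c)) mod m = 0" by (simp add: m_def)
  moreover have "(\<forall>i\<ge>K. u i = 0) \<and> (fragment_step (K + L) (compile K (While r c)))\<^sup>*\<^sup>*
           (0, registers (K + L) t) (fst (compile K (While r c)), registers (K + L) u)"
    using WhileTrue by simp
  ultimately show ?case
    by (metis (no_types, lifting) converse_rtranclp_into_rtranclp rtranclp_trans)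
next
  case (Call f r s)
  have "fst (call_fragment K (machine_for f) r) = num_states (machine_for f)"
    by (simp add: call_fragment_def)
  moreover have "\<forall>i\<ge>K. (s(r := f (s r))) i = 0" using Call by simp
  ultimately show ?case
    using call_fragment_correct[OF machine_for(1)[of f], of L r K s "f (s r)"] machine_for(2)[of f "s r"] Call
    by (simp del: fun_upd_apply)
qed

theorem machine_of_program:
  assumes "calls_computable c"
  obtains M where "turing_machine_wf M"
    "\<And>ns r. length ns \<le> k \<Longrightarrow> big_step c (\<lambda>i. if i < length ns then ns ! i else 0) ((\<lambda>_. 0)(0 := r)) \<Longrightarrow> tm_computes M ns r"
proof -
  obtain K0 L S0 where f0: "fits K0 L S0 c" using ex_fits by blast
  \<comment> \<open>Room for all inputs, and at least one tape for the output.\<close>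
  define K where "K = max K0 (Suc k)"
  define S where "S = max 2 S0"
  have f: "fits K L S c" using f0 by (rule fits_mono) (auto simp: K_def S_def)
  define P where "P = compile K c"
  define M where "M = fragment_machine (K + L) S P"
  have wf: "fragment_wf (K + L) S P"
    unfolding P_def using f assms by (rule compile_wf) (simp add: S_def)
  have M: "turing_machine_wf M"
    using wf unfolding turing_machine_wf_def M_def fragment_machine_def fragment_wf_def
    by (auto simp: K_def S_def le_less_Suc_eq in_set_conv_nth less_Suc_eq_le)
       (metis fst_conv)+
  have step: "tm_next M c = Some c'" if "fragment_step (K + L) P c c'" for c c'
    using that by (cases c; cases c')
      (auto simp: M_def fragment_machine_def fragment_step_def split: prod.splits intro!: nth_equalityI)
  have "tm_computes M ns m" if ns: "length ns \<le> k"
    and b: "big_step c (\<lambda>i. if i < length ns then ns ! i else 0) ((\<lambda>_. 0)(0 := m))" for ns m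
  proof -
    let ?s = "\<lambda>i. if i < length ns then ns ! i else 0"
    have T: "num_tapes M = K + L" by (simp add: M_def fragment_machine_def)
    have i: "registers (K + L) ?s = tm_input M ns"
      using ns by (auto simp: T tm_input_def registers_def nth_append unary_tape_zero K_def intro!: nth_equalityI)
    have o: "registers (K + L) ((\<lambda>_. 0)(0 := m)) = tm_output M m"
      by (auto simp: T tm_output_def registers_def nth_Cons unary_tape_zero K_def intro!: nth_equalityI split: nat.splits)
    have "(fragment_step (K + L) P)\<^sup>*\<^sup>* (0, tm_input M ns) (fst P, tm_output M m)"
      using compile_correct[OF b f assms] ns unfolding P_def i o by (simp add: K_def)
    then have "(\<lambda>c c'. tm_next M c = Some c')\<^sup>*\<^sup>* (0, tm_input M ns) (fst P, tm_output M m)"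
      by (rule rtranclp_mono[THEN predicate2D, rotated]) (auto dest: step)
    moreover have "tm_next M (fst P, tm_output M m) = None"
      by (simp add: M_def fragment_machine_def)
    ultimately show ?thesis
      using ns by (auto simp: tm_computes_def T K_def)
  qed
  with M that show ?thesis by blast
qed

section \<open>Closure properties of the computable functions\<close>

lemma computableI:
  assumes "calls_computable c" "\<And>n. big_step c ((\<lambda>_. 0)(0 := n)) ((\<lambda>_. 0)(0 := f n))"
  shows "computable f"
proof -
  obtain M where M: "turing_machine_wf M"
    "\<And>ns r. length ns \<le> 1 \<Longrightarrow> big_step c (\<lambda>i. if i < length ns then ns ! i else 0) ((\<lambda>_. 0)(0 := r)) \<Longrightarrow> tm_computes M ns r"
    using machine_of_program[OF assms(1)] by blast
  have "(\<lambda>i. if i < length [n] then [n] ! i else 0) = (\<lambda>_. 0)(0 := n)" for n :: nat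
    by auto
  with M(2)[of "[_]"] assms(2) have "tm_computes M [n] (f n)" for n by simp
  with M(1) show ?thesis by (auto simp: computable_def)
qed

text \<open>Reduces a count-down loop to a closed form for the iterates of \<open>F\<close>, the
  effect of its body.\<close>

lemma big_step_For:
  assumes "\<And>s. P s \<Longrightarrow> s r \<noteq> 0 \<Longrightarrow> big_step c s (F s) \<and> P (F s) \<and> F s r = s r - 1" "P s"
  shows "big_step (While r c) s ((F ^^ s r) s)"
  using assms(2)
proof (induction "s r" arbitrary: s)
  case 0
  then show ?case using WhileFalse[of s r c] by simp
next
  case (Suc n)
  then have F: "big_step c s (F s)" "P (F s)" "F s r = n" using assms(1)[of s] by auto
  from Suc(1)[of "F s"] F have "big_step (While r c) (F s) ((F ^^ n) (F s))" by simp
  then show ?case using F(1) Suc(2) by (metis WhileTrue funpow_Suc_right comp_apply nat.distinct(1))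
qed

section \<open>Register macros and the pairing programs\<close>

lemma big_step_eq: "big_step c s t \<Longrightarrow> t = t' \<Longrightarrow> big_step c s t'"
  by simp

lemma big_step_Zero: "big_step (While r (Dec r)) s (s(r := 0))"
proof -
  have "((\<lambda>s. s(r := s r - 1)) ^^ n) s = s(r := s r - n)" for n
    by (induction n) (auto simp: fun_eq_iff)
  moreover have "big_step (While r (Dec r)) s (((\<lambda>s. s(r := s r - 1)) ^^ s r) s)"
    by (rule big_step_For[where P="\<lambda>_. True"]) (auto intro: Dec[unfolded One_nat_def])
  ultimately show ?thesis by simp
qed

text \<open>A register can only be read by emptying it; copying therefore moves it to two targets
  and restores it from one of them.\<close>

definition Move2 :: "nat \<Rightarrow> nat \<Rightarrow> nat \<Rightarrow> com" where
  "Move2 a b c = While a (Dec a ;; Inc b ;; Inc c)"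

lemma big_step_Move2:
  assumes "distinct [a, b, c]"
  shows "big_step (Move2 a b c) s (s(a := 0, b := s b + s a, c := s c + s a))"
proof -
  let ?F = "\<lambda>s. s(a := s a - 1, b := Suc (s b), c := Suc (s c))"
  have it: "(?F ^^ n) s = s(a := s a - n, b := s b + n, c := s c + n)" for n
    using assms by (induction n) (auto simp: fun_eq_iff)
  have "big_step (Move2 a b c) s ((?F ^^ s a) s)"
    unfolding Move2_def
  proof (rule big_step_For[where P="\<lambda>_. True"], intro conjI)
    fix s
    show "big_step (Dec a ;; Inc b ;; Inc c) s (?F s)"
      by (rule big_step_eq, rule Seq[OF Dec], rule Seq[OF Inc], rule Inc) (use assms in auto)
  qed (use assms in auto)
  then show ?thesis unfolding it by simp
qed

definition Move :: "nat \<Rightarrow> nat \<Rightarrow> com" where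
  "Move a b = While a (Dec a ;; Inc b)"

lemma big_step_Move:
  assumes "a \<noteq> b"
  shows "big_step (Move a b) s (s(a := 0, b := s b + s a))"
proof -
  let ?F = "\<lambda>s. s(a := s a - 1, b := Suc (s b))"
  have it: "(?F ^^ n) s = s(a := s a - n, b := s b + n)" for n
    using assms by (induction n) (auto simp: fun_eq_iff)
  have "big_step (Move a b) s ((?F ^^ s a) s)"
    unfolding Move_def
  proof (rule big_step_For[where P="\<lambda>_. True"], intro conjI)
    fix s
    show "big_step (Dec a ;; Inc b) s (?F s)"
      by (rule big_step_eq, rule Seq[OF Dec], rule Inc) (use assms in auto)
  qed (use assms in auto)
  then show ?thesis unfolding it by simp
qed

definition Copy :: "nat \<Rightarrow> nat \<Rightarrow> nat \<Rightarrow> com" where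
  "Copy a b t = Move2 a b t ;; Move t a"

lemma big_step_Copy:
  assumes "distinct [a, b, t]" "s t = 0"
  shows "big_step (Copy a b t) s (s(b := s b + s a))"
  unfolding Copy_def
  by (rule big_step_eq, rule Seq[OF big_step_Move2 big_step_Move]) (use assms in \<open>auto simp: fun_eq_iff\<close>)

text \<open>The code of \<open>(a, b)\<close> is \<open>a\<close> plus the sum of the numbers up to \<open>a + b\<close>; conversely, decoding
  enumerates the pairs in the order of their codes.\<close>

definition Encode :: com where
  "Encode = Move2 0 1 2 ;; While 1 (Copy 1 2 3 ;; Dec 1) ;; Move 2 0"

lemma big_step_Encode:
  assumes "s 2 = 0" "s 3 = 0"
  shows "big_step Encode s (s(0 := prod_encode (s 0, s 1), 1 := 0))"
proof -
  let ?F = "\<lambda>s. s(1 := s 1 - 1, 2 := s 2 + s 1) :: nat \<Rightarrow> nat"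
  have it: "n \<le> t 1 \<Longrightarrow> (?F ^^ n) t = t(1 := t 1 - n, 2 := t 2 + (triangle (t 1) - triangle (t 1 - n)))" for n t
  proof (induction n)
    case (Suc n)
    then obtain m where m: "t 1 - n = Suc m" "t 1 - Suc n = m" by (metis Suc_diff_Suc Suc_le_lessD)
    \<comment> \<open>Monotonicity is needed because the difference of triangular numbers in
      \<open>it\<close> is truncated.\<close>
    have "triangle (Suc m) \<le> triangle (t 1)"
      unfolding triangle_def m(1)[symmetric] by (intro div_le_mono mult_le_mono) auto
    then show ?case using Suc m by (auto simp: fun_eq_iff)
  qed (auto simp: fun_eq_iff)
  have "big_step (While 1 (Copy 1 2 3 ;; Dec 1)) t ((?F ^^ t 1) t)" if "t 3 = 0" for t
  proof (rule big_step_For[where P="\<lambda>t. t 3 = 0"], intro conjI)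
    fix s :: "nat \<Rightarrow> nat" assume "s 3 = 0"
    then show "big_step (Copy 1 2 3 ;; Dec 1) s (?F s)"
      by (intro big_step_eq[OF Seq[OF big_step_Copy Dec]]) (auto simp: fun_eq_iff)
  qed (use that in auto)
  then have loop: "big_step (While 1 (Copy 1 2 3 ;; Dec 1)) t (t(1 := 0, 2 := t 2 + triangle (t 1)))" if "t 3 = 0" for t
    by (rule big_step_eq) (use that in \<open>simp_all only: it order_refl, simp\<close>)
  show ?thesis
    unfolding Encode_def
  proof (rule big_step_eq, rule Seq[OF big_step_Move2], simp, rule Seq[OF loop])
    show "big_step (Move 2 0) t (t(2 := 0, 0 := t 0 + t 2))" for t
      by (rule big_step_Move) simp
  qed (use assms in \<open>auto simp: fun_eq_iff prod_encode_def add.commute\<close>)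
qed

text \<open>Registers 1 and 2 hold the current pair and register 0 the number of steps left.
  Register 3 is a flag that stays 1 only if the second component is 0. The two inner loops act as
  conditionals: their bodies empty the tested register, so they run at most once.\<close>

definition Decode :: com where
  "Decode = While 0 (Dec 0 ;; Inc 3 ;; Move 2 4 ;;
     While 4 (Dec 4 ;; Move 4 2 ;; Dec 3 ;; Inc 1) ;;
     While 3 (Dec 3 ;; Move 1 2 ;; Inc 2))"

text \<open>Codes run through the antidiagonals of constant \<open>a + b\<close>, each from
  \<open>a = 0\<close> upwards.\<close>

lemma prod_decode_Suc:
  "prod_decode (Suc n) = (case prod_decode n of (a, b) \<Rightarrow> if b = 0 then (0, Suc a) else (Suc a, b - 1))"
proof -
  obtain a b where ab: "prod_decode n = (a, b)" by force
  have "prod_encode (if b = 0 then (0, Suc a) else (Suc a, b - 1)) = Suc (prod_encode (a, b))"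
    by (cases b) (simp_all add: prod_encode_def)
  also have "prod_encode (a, b) = n" by (metis ab prod_decode_inverse)
  finally show ?thesis by (metis (mono_tags, lifting) ab case_prod_conv prod_encode_inverse)
qed

lemma big_step_Decode:
  "big_step Decode ((\<lambda>_. 0)(0 := n)) ((\<lambda>_. 0)(1 := fst (prod_decode n), 2 := snd (prod_decode n)))"
proof -
  let ?st = "\<lambda>k m. (\<lambda>_. 0)(0 := k, 1 := fst (prod_decode m), 2 := snd (prod_decode m)) :: nat \<Rightarrow> nat"
  have step: "big_step (Dec 0 ;; Inc 3 ;; Move 2 4 ;;
     While 4 (Dec 4 ;; Move 4 2 ;; Dec 3 ;; Inc 1) ;;
     While 3 (Dec 3 ;; Move 1 2 ;; Inc 2)) (?st (Suc k) m) (?st k (Suc m))" for k m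
  proof -
    obtain a b where ab: "prod_decode m = (a, b)" by force
    have pre: "big_step c ((\<lambda>_. 0)(0 := k, 1 := a, 3 := 1, 4 := b)) u \<Longrightarrow>
      big_step (Dec 0 ;; Inc 3 ;; Move 2 4 ;; c) (?st (Suc k) m) u" for c u
      by (rule Seq[OF Dec], rule Seq[OF Inc], rule Seq[OF big_step_Move], simp)
         (erule back_subst[where P="\<lambda>s. big_step c s u"], auto simp: ab fun_eq_iff)
    have "big_step (While 4 (Dec 4 ;; Move 4 2 ;; Dec 3 ;; Inc 1) ;; While 3 (Dec 3 ;; Move 1 2 ;; Inc 2))
        ((\<lambda>_. 0)(0 := k, 1 := a, 3 := 1, 4 := b)) (?st k (Suc m))"
    proof (cases b)
      case 0
      show ?thesis
        by (rule big_step_eq, rule Seq[OF WhileFalse], (simp add: 0; fail), rule WhileTrue[OF _ Seq[OF Dec Seq[OF big_step_Move Inc]] WhileFalse])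
           (auto simp: 0 ab prod_decode_Suc fun_eq_iff)
    next
      case (Suc b')
      show ?thesis
        by (rule big_step_eq, rule Seq[OF WhileTrue[OF _ Seq[OF Dec Seq[OF big_step_Move Seq[OF Dec Inc]]] WhileFalse] WhileFalse])
           (auto simp: Suc ab prod_decode_Suc fun_eq_iff)
    qed
    then show ?thesis by (rule pre)
  qed
  have "big_step Decode (?st k m) (?st 0 (m + k))" for k m
  proof (induction k arbitrary: m)
    case 0
    show ?case unfolding Decode_def by (rule big_step_eq, rule WhileFalse) auto
  next
    case (Suc k)
    show ?case
      unfolding Decode_def
    proof (rule WhileTrue[OF _ step])
      show "?st (Suc k) m 0 \<noteq> 0" by simp
    qed (rule Suc[of "Suc m", unfolded Decode_def add_Suc_shift])
  qed
  moreover have "prod_decode 0 = (0, 0)"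
    by (simp add: prod_decode_def prod_decode_aux.simps)
  then have "?st n 0 = (\<lambda>_. 0)(0 := n)" by auto
  ultimately show ?thesis by (metis add_0 fun_upd_triv)
qed

lemma calls_computable_macros [simp]: "calls_computable (Move a b)" "calls_computable (Move2 a b c)" "calls_computable (Copy a b c)"
  "calls_computable Encode" "calls_computable Decode"
  by (simp_all add: Move_def Move2_def Copy_def Encode_def Decode_def)

text \<open>Since \<open>computable\<close> concerns unary functions, all further arguments and
  parameters travel through this pairing.\<close>

definition pair :: "nat \<Rightarrow> nat \<Rightarrow> nat" where "pair a b = prod_encode (a, b)"
definition pair_fst :: "nat \<Rightarrow> nat" where "pair_fst n = fst (prod_decode n)"
definition pair_snd :: "nat \<Rightarrow> nat" where "pair_snd n = snd (prod_decode n)"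

lemma pair_sel [simp]: "pair_fst (pair a b) = a" "pair_snd (pair a b) = b"
  by (simp_all add: pair_def pair_fst_def pair_snd_def)

section \<open>Composition, primitive recursion and arithmetic\<close>

lemma computable_id: "computable (\<lambda>n. n)"
  by (rule computableI[of "Move 0 1 ;; Move 1 0"], simp,
      rule big_step_eq, rule Seq[OF big_step_Move big_step_Move]) auto

lemma computable_comp:
  assumes "computable f" "computable g"
  shows "computable (\<lambda>n. f (g n))"
  by (rule computableI[of "Call g 0 ;; Call f 0"], simp add: assms,
      rule big_step_eq, rule Seq[OF Call Call]) simp

lemma computable_zero: "computable (\<lambda>_. 0)"
  by (rule computableI[of "While 0 (Dec 0)"], simp, rule big_step_eq, rule big_step_Zero) simp

lemma computable_Suc': "computable Suc"
  by (rule computableI[of "Inc 0"], simp, rule big_step_eq, rule Inc) simp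

lemmas computable_Suc = computable_comp[OF computable_Suc']

lemma computable_const: "computable (\<lambda>_. c)"
  by (induction c) (auto intro: computable_zero computable_Suc)

lemma computable_pair_fst': "computable pair_fst"
proof (rule computableI[of "Decode ;; While 2 (Dec 2) ;; Move 1 0"])
  show "big_step (Decode ;; While 2 (Dec 2) ;; Move 1 0) ((\<lambda>_. 0)(0 := n)) ((\<lambda>_. 0)(0 := pair_fst n))" for n
    by (rule big_step_eq, rule Seq[OF big_step_Decode], rule Seq[OF big_step_Zero], rule big_step_Move)
       (auto simp: pair_fst_def fun_eq_iff)
qed simp

lemma computable_pair_snd': "computable pair_snd"
proof (rule computableI[of "Decode ;; While 1 (Dec 1) ;; Move 2 0"])
  show "big_step (Decode ;; While 1 (Dec 1) ;; Move 2 0) ((\<lambda>_. 0)(0 := n)) ((\<lambda>_. 0)(0 := pair_snd n))" for n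
    by (rule big_step_eq, rule Seq[OF big_step_Decode], rule Seq[OF big_step_Zero], rule big_step_Move)
       (auto simp: pair_snd_def fun_eq_iff)
qed simp

lemmas computable_pair_fst = computable_comp[OF computable_pair_fst']
lemmas computable_pair_snd = computable_comp[OF computable_pair_snd']

lemma computable_pair:
  assumes "computable f" "computable g"
  shows "computable (\<lambda>n. pair (f n) (g n))"
proof (rule computableI[of "Copy 0 1 2 ;; Call f 0 ;; Call g 1 ;; Encode"])
  show "big_step (Copy 0 1 2 ;; Call f 0 ;; Call g 1 ;; Encode) ((\<lambda>_. 0)(0 := n)) ((\<lambda>_. 0)(0 := pair (f n) (g n)))" for n
    by (rule big_step_eq, rule Seq[OF big_step_Copy], simp, simp, rule Seq[OF Call], rule Seq[OF Call], rule big_step_Encode)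
       (auto simp: pair_def fun_eq_iff)
qed (use assms in simp)

lemma computable_funpow:
  assumes "computable F"
  shows "computable (\<lambda>z. (F ^^ pair_snd z) (pair_fst z))"
proof -
  let ?c = "Copy 0 1 2 ;; Call pair_fst 0 ;; Call pair_snd 1 ;; While 1 (Dec 1 ;; Call F 0)"
  let ?G = "\<lambda>s. s(1 := s 1 - 1, 0 := F (s 0))"
  have "big_step (While 1 (Dec 1 ;; Call F 0)) s ((?G ^^ s 1) s)" for s
  proof (rule big_step_For[where P="\<lambda>_. True"], intro conjI)
    show "big_step (Dec 1 ;; Call F 0) s (?G s)" for s
      by (rule big_step_eq, rule Seq[OF Dec Call]) auto
  qed auto
  have it: "(?G ^^ n) s = s(1 := s 1 - n, 0 := (F ^^ n) (s 0))" for n s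
    by (induction n) (auto simp: fun_eq_iff)
  have loop: "big_step (While 1 (Dec 1 ;; Call F 0)) s (s(1 := 0, 0 := (F ^^ s 1) (s 0)))" for s
    by (rule big_step_eq, fact) (simp only: it, simp)
  show ?thesis
  proof (rule computableI[of ?c])
    show "big_step ?c ((\<lambda>_. 0)(0 := n)) ((\<lambda>_. 0)(0 := (F ^^ pair_snd n) (pair_fst n)))" for n
      by (rule big_step_eq, rule Seq[OF big_step_Copy], simp, simp, rule Seq[OF Call], rule Seq[OF Call], rule loop)
         (auto simp: fun_eq_iff)
  qed (simp add: assms computable_pair_fst' computable_pair_snd')
qed

text \<open>Primitive recursion with a parameter is iteration on triples of parameter, step index
  and current value.\<close>

lemma computable_rec_nat:
  assumes "computable n" "computable a"
    and "computable (\<lambda>p. h (pair_fst p) (pair_fst (pair_snd p)) (pair_snd (pair_snd p)))"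
  shows "computable (\<lambda>z. rec_nat (a z) (h z) (n z))"
proof -
  let ?F = "\<lambda>p. pair (pair_fst p) (pair (Suc (pair_fst (pair_snd p)))
     (h (pair_fst p) (pair_fst (pair_snd p)) (pair_snd (pair_snd p))))"
  have F: "computable ?F"
    by (intro computable_pair computable_pair_fst computable_pair_snd computable_Suc computable_id assms(3))
  have "(?F ^^ k) (pair z (pair 0 (a z))) = pair z (pair k (rec_nat (a z) (h z) k))" for k z
    by (induction k) simp_all
  moreover have "computable (\<lambda>z. pair_snd (pair_snd ((\<lambda>q. (?F ^^ pair_snd q) (pair_fst q)) (pair (pair z (pair 0 (a z))) (n z)))))"
    by (intro computable_pair_snd computable_comp[OF computable_funpow[OF F]] computable_pair computable_id computable_const assms)
  ultimately show ?thesis by simp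
qed

lemma computable_pred: assumes "computable f" shows "computable (\<lambda>z. f z - 1)"
proof -
  have "rec_nat 0 (\<lambda>i _. i) n = n - 1" for n by (cases n) auto
  moreover have "computable (\<lambda>z. rec_nat 0 (\<lambda>i _. i) (f z))"
    by (rule computable_rec_nat[where h="\<lambda>_ i _. i"])
       (intro assms computable_const computable_pair_fst computable_pair_snd computable_id)+
  ultimately show ?thesis by simp
qed

lemma computable_diff: assumes "computable f" "computable g" shows "computable (\<lambda>z. f z - g z)"
proof -
  have "rec_nat m (\<lambda>_ r. r - 1) n = m - n" for m n :: nat by (induction n) auto
  moreover have "computable (\<lambda>z. rec_nat (f z) (\<lambda>_ r. r - 1) (g z))"
    by (rule computable_rec_nat[where h="\<lambda>_ _ r. r - 1"])
       (intro assms computable_pred computable_const computable_pair_fst computable_pair_snd computable_id)+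
  ultimately show ?thesis by simp
qed

lemma computable_add: assumes "computable f" "computable g" shows "computable (\<lambda>z. f z + g z)"
proof -
  have "rec_nat m (\<lambda>_ r. Suc r) n = m + n" for m n :: nat by (induction n) auto
  moreover have "computable (\<lambda>z. rec_nat (f z) (\<lambda>_ r. Suc r) (g z))"
    by (rule computable_rec_nat[where h="\<lambda>_ _ r. Suc r"])
       (intro assms computable_Suc computable_const computable_pair_fst computable_pair_snd computable_id)+
  ultimately show ?thesis by simp
qed

lemma computable_sum:
  assumes "computable n" "computable (\<lambda>p. f (pair_fst p) (pair_snd p))"
  shows "computable (\<lambda>z. \<Sum>i<n z. f z i)"
proof -
  have "rec_nat 0 (\<lambda>i r. r + f z i) n = (\<Sum>i<n. f z i)" for n z by (induction n) auto
  moreover have "computable (\<lambda>p. pair (pair_fst p) (pair_fst (pair_snd p)))"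
    by (intro computable_pair computable_pair_fst computable_pair_snd computable_id)
  from computable_comp[OF assms(2) this] have "computable (\<lambda>p. f (pair_fst p) (pair_fst (pair_snd p)))"
    by simp
  then have "computable (\<lambda>p. pair_snd (pair_snd p) + f (pair_fst p) (pair_fst (pair_snd p)))"
    by (rule computable_add[rotated]) (intro computable_pair_snd computable_id)
  then have "computable (\<lambda>z. rec_nat 0 (\<lambda>i r. r + f z i) (n z))"
    by (rule computable_rec_nat[where h="\<lambda>z i r. r + f z i", OF assms(1) computable_const])
  ultimately show ?thesis by simp
qed

lemma computable_mult: assumes "computable f" "computable g" shows "computable (\<lambda>z. f z * g z)"
proof -
  have "computable (\<lambda>z. \<Sum>i<g z. f z)"
    by (rule computable_sum[where f="\<lambda>z _. f z", OF assms(2) computable_comp[OF assms(1) computable_pair_fst']])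
  then show ?thesis by (simp add: mult.commute)
qed

lemma computable_le: assumes "computable f" "computable g" shows "computable (\<lambda>z. of_bool (f z \<le> g z))"
proof -
  have "(of_bool (m \<le> n) :: nat) = 1 - (m - n)" for m n :: nat by auto
  moreover have "computable (\<lambda>z. 1 - (f z - g z))"
    by (intro assms computable_diff computable_const)
  ultimately show ?thesis by simp
qed

lemma computable_neq: assumes "computable f" "computable g" shows "computable (\<lambda>z. of_bool (f z \<noteq> g z))"
proof -
  have "(of_bool (m \<noteq> n) :: nat) = 1 - of_bool (m \<le> n) * of_bool (n \<le> m)" for m n :: nat by auto
  moreover have "computable (\<lambda>z. 1 - of_bool (f z \<le> g z) * of_bool (g z \<le> f z))"
    by (intro assms computable_diff computable_const computable_mult computable_le)
  ultimately show ?thesis by simp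
qed

lemma computable_eq: assumes "computable f" "computable g" shows "computable (\<lambda>z. of_bool (f z = g z))"
proof -
  have "(of_bool (m = n) :: nat) = 1 - of_bool (m \<noteq> n)" for m n :: nat by auto
  moreover have "computable (\<lambda>z. 1 - of_bool (f z \<noteq> g z))"
    by (intro assms computable_diff computable_const computable_neq)
  ultimately show ?thesis by simp
qed

text \<open>Unbounded search. The machine takes two inputs and is required to halt only where a
  solution exists, so it is obtained from the compiler directly and not through
  \<open>computable\<close>. Register 1 holds the value of \<open>Q\<close> and is thus 0 on leaving
  the loop, as the output format demands.\<close>

lemma machine_search:
  assumes "computable Q" "computable G"
  obtains M where "turing_machine_wf M"
    "\<And>a b z. Q (pair (pair a b) z) = 0 \<Longrightarrow>
       \<exists>z. Q (pair (pair a b) z) = 0 \<and> tm_computes M [a, b] (G (pair (pair a b) z))"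
proof -
  define I where "I = (\<lambda>y. pair y 0)"
  define N where "N = (\<lambda>p. pair (pair_fst p) (Suc (pair_snd p)))"
  have IN: "computable I" "computable N"
    unfolding I_def N_def
    by (intro computable_pair computable_id computable_const computable_pair_fst computable_pair_snd computable_Suc)+
  let ?loop = "While 1 (While 1 (Dec 1) ;; Call N 0 ;; Copy 0 1 2 ;; Call Q 1)"
  let ?c = "Encode ;; Call I 0 ;; Copy 0 1 2 ;; Call Q 1 ;; ?loop ;; Call G 0"
  let ?st = "\<lambda>y k. (\<lambda>_. 0)(0 := pair y k, 1 := Q (pair y k))"
  have "calls_computable ?c" using assms IN by simp
  then obtain M where M: "turing_machine_wf M"
    "\<And>ns r. length ns \<le> 2 \<Longrightarrow> big_step ?c (\<lambda>i. if i < length ns then ns ! i else 0) ((\<lambda>_. 0)(0 := r)) \<Longrightarrow> tm_computes M ns r"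
    using machine_of_program by blast
  have body: "big_step (While 1 (Dec 1) ;; Call N 0 ;; Copy 0 1 2 ;; Call Q 1) (?st y k) (?st y (Suc k))" for y k
    by (rule big_step_eq, rule Seq[OF big_step_Zero], rule Seq[OF Call], rule Seq[OF big_step_Copy], simp, simp, rule Call)
       (auto simp: N_def fun_eq_iff)
  \<comment> \<open>Induction on the distance \<open>d\<close> to a known solution; the loop may
    stop at an earlier one.\<close>
  have loop: "\<exists>z. Q (pair y z) = 0 \<and> big_step ?loop (?st y k) (?st y z)"
    if "Q (pair y (k + d)) = 0" for y k d
    using that
  proof (induction d arbitrary: k)
    case 0
    have "big_step ?loop (?st y k) (?st y k)"
      by (rule WhileFalse) (use 0 in simp)
    then show ?case using 0[unfolded add_0_right] by blast
  next
    case (Suc d)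
    show ?case
    proof (cases "Q (pair y k) = 0")
      case True
      have "big_step ?loop (?st y k) (?st y k)"
        by (rule WhileFalse) (use True in simp)
      then show ?thesis using True by blast
    next
      case False
      have "Q (pair y (Suc k + d)) = 0" using Suc.prems by simp
      from Suc.IH[OF this] obtain z where z: "Q (pair y z) = 0" "big_step ?loop (?st y (Suc k)) (?st y z)"
        by blast
      have "big_step ?loop (?st y k) (?st y z)"
        by (rule WhileTrue[OF _ body z(2)]) (use False in simp)
      then show ?thesis using z(1) by blast
    qed
  qed
  have "\<exists>z. Q (pair (pair a b) z) = 0 \<and> tm_computes M [a, b] (G (pair (pair a b) z))"
    if q: "Q (pair (pair a b) z) = 0" for a b z
  proof -
    obtain z' where z': "Q (pair (pair a b) z') = 0" "big_step ?loop (?st (pair a b) 0) (?st (pair a b) z')"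
      using loop[of "pair a b" 0 z] q by auto
    have s: "(\<lambda>i. if i < length [a, b] then [a, b] ! i else 0) = (\<lambda>_. 0)(0 := a, 1 := b)"
      by (auto simp: fun_eq_iff nth_Cons split: nat.splits)
    have fin: "big_step (?loop ;; Call G 0) (?st (pair a b) 0) ((\<lambda>_. 0)(0 := G (pair (pair a b) z')))"
      by (rule big_step_eq, rule Seq[OF z'(2) Call]) (use z'(1) in \<open>auto simp: fun_eq_iff\<close>)
    have "big_step ?c ((\<lambda>_. 0)(0 := a, 1 := b)) ((\<lambda>_. 0)(0 := G (pair (pair a b) z')))"
      by (rule Seq[OF big_step_Encode], simp, simp, rule Seq[OF Call], rule Seq[OF big_step_Copy], simp, simp, rule Seq[OF Call])
         (rule back_subst[where P="\<lambda>s. big_step (?loop ;; Call G 0) s _", OF fin], auto simp: I_def pair_def fun_eq_iff)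
    then have "tm_computes M [a, b] (G (pair (pair a b) z'))"
      by (intro M(2)) (simp_all only: s, simp)
    then show ?thesis using z'(1) by blast
  qed
  with M(1) that show ?thesis by blast
qed

section \<open>Computing frequencies from uniform convergence\<close>

lemma length_subword [simp]: "length (subword x i j) = j - i"
  by (simp add: subword_def)

lemma nth_subword [simp]: "k < j - i \<Longrightarrow> subword x i j ! k = x (i + k)"
  by (simp add: subword_def)

lemma subword_eq_iff: "subword x i (i + length v) = v \<longleftrightarrow> (\<forall>k<length v. x (i + k) = v ! k)"
  by (auto simp: list_eq_iff_nth_eq)

lemma subword_eq_subword_iff:
  "subword x i (i + n) = subword x j (j + n) \<longleftrightarrow> (\<forall>k<n. x (i + k) = x (j + k))"
  by (auto simp: list_eq_iff_nth_eq)

lemma factor_subword: "i \<le> j \<Longrightarrow> factor x (subword x i j)"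
  by (auto simp: factor_def)

text \<open>Makes the maximum in \<open>longest_return\<close> an upper bound: there are finitely
  many words of each length over a finite alphabet.\<close>

lemma finite_return_lengths:
  fixes x :: "nat \<Rightarrow> 'a::finite"
  assumes "uniformly_recurrent x"
  shows "finite {length r | r. \<exists>u. factor x u \<and> length u = n \<and> return_word x u r}"
proof -
  have "finite {u :: 'a list. length u = n}"
    using finite_lists_length_eq[of "UNIV :: 'a set" n] by simp
  then have "finite (\<Union>u\<in>{u. length u = n \<and> factor x u}. length ` {r. return_word x u r})"
    using assms by (intro finite_UN_I) (auto simp: uniformly_recurrent_def intro: finite_subset)
  then show ?thesis by (rule finite_subset[rotated]) auto
qed

text \<open>The first occurrence, at \<open>p\<close>, belongs to a prefix of \<open>x\<close> that recurs at some \<open>q > p\<close>; so \<open>v\<close> occurs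
  at \<open>q + p\<close> but not in \<open>{q..<q + p}\<close>, and the return word ending at \<open>q + p\<close> is longer than \<open>p\<close>.\<close>

lemma first_occurrence_less_longest_return:
  fixes x :: "nat \<Rightarrow> 'a::finite"
  assumes ur: "uniformly_recurrent x" and v: "factor x v"
  shows "\<exists>p<longest_return x (length v). subword x p (p + length v) = v"
proof -
  let ?m = "length v"
  define S where "S = {i. subword x i (i + ?m) = v}"
  have rec: "factor x u \<Longrightarrow> infinite {i. subword x i (i + length u) = u}" for u
    using ur by (simp add: uniformly_recurrent_def recurrent_def occurs_infinitely_often_def)
  have "infinite S" using rec[OF v] by (simp add: S_def)
  then obtain p0 where "p0 \<in> S" by (metis finite.emptyI ex_in_conv)
  define p where "p = (LEAST i. i \<in> S)"
  have p_min: "i \<notin> S" if "i < p" for i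
    using that not_less_Least unfolding p_def by auto
  have pS: "p \<in> S" using \<open>p0 \<in> S\<close> unfolding p_def by (rule LeastI)
  define w where "w = subword x 0 (p + ?m)"
  have "infinite {i. subword x i (i + length w) = w}"
    by (rule rec) (simp add: w_def factor_subword)
  then obtain q where q: "q > p" "subword x q (q + length w) = w"
    by (metis (mono_tags, lifting) infinite_nat_iff_unbounded mem_Collect_eq)
  have qx: "x (q + k) = x k" if "k < p + ?m" for k
    using q(2)[unfolded subword_eq_iff] that by (simp add: w_def)
  have qS: "q + i \<in> S \<longleftrightarrow> i \<in> S" if "i \<le> p" for i
  proof -
    have "x (q + i + k) = x (i + k)" if "k < ?m" for k
      using qx[of "i + k"] that \<open>i \<le> p\<close> by (simp add: add.assoc)
    then show ?thesis by (simp add: S_def subword_eq_iff)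
  qed
  define t where "t = Max {i \<in> S. i < q}"
  have fin: "finite {i \<in> S. i < q}" "{i \<in> S. i < q} \<noteq> {}" using pS q(1) by auto
  have t: "t \<in> S" "t < q" using Max_in[OF fin] by (auto simp: t_def)
  \<comment> \<open>Below \<open>q\<close> this is maximality of \<open>t\<close>; from
    \<open>q\<close> on it is minimality of \<open>p\<close>, read in the copy of the prefix at
    \<open>q\<close>.\<close>
  have gap: "i \<notin> S" if i: "t < i" "i < q + p" for i
  proof (cases "i < q")
    case True
    show ?thesis
    proof
      assume "i \<in> S"
      with True have "i \<le> t" unfolding t_def by (intro Max_ge fin(1)) simp
      with i(1) show False by simp
    qed
  next
    case False
    then show ?thesis using qS[of "i - q"] p_min[of "i - q"] i(2) by auto
  qed
  define r where "r = subword x t (q + p)"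
  have len: "length r = q + p - t" by (simp add: r_def)
  have v_nth: "v ! k = x (q + p + k)" if "k < ?m" for k
    using qS[of p] pS that by (simp add: S_def subword_eq_iff)
  have rv: "r @ v = subword x t (q + p + ?m)"
    using t(2) by (auto simp: list_eq_iff_nth_eq nth_append len v_nth r_def add.commute)
  have "occurrences v (r @ v) = {i. i \<le> length r \<and> t + i \<in> S}"
  proof -
    have "take ?m (drop i (r @ v)) = v \<longleftrightarrow> t + i \<in> S" if "i \<le> length r" for i
    proof -
      have "take ?m (drop i (r @ v)) = subword x (t + i) (t + i + ?m)"
        unfolding rv using that t(2) by (auto simp: list_eq_iff_nth_eq len add.assoc)
      then show ?thesis by (simp add: S_def)
    qed
    then show ?thesis by (auto simp: occurrences_def)
  qed
  also have "\<dots> = {0, length r}"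
  proof (intro equalityI subsetI)
    fix i assume i: "i \<in> {i. i \<le> length r \<and> t + i \<in> S}"
    then have "\<not> (t < t + i \<and> t + i < q + p)" using gap by blast
    then show "i \<in> {0, length r}" using i t(2) by (auto simp: len)
  next
    have "q + p \<in> S" using qS[of p] pS by simp
    then show "i \<in> {i. i \<le> length r \<and> t + i \<in> S}" if "i \<in> {0, length r}" for i
      using that t by (auto simp: len)
  qed
  finally have "card (occurrences v (r @ v)) = 2" "0 \<in> occurrences v (r @ v)" using t(2) by (auto simp: len)
  moreover have "prefix v (r @ v)"
    using calculation(2) take_is_prefix[of ?m "r @ v"] by (simp add: occurrences_def del: take_append)
  moreover have "factor x (r @ v)" unfolding rv by (rule factor_subword) (use t(2) in simp)
  ultimately have "return_word x v r"
    by (simp add: return_word_def suffix_def)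
  then have "length r \<in> {length r | r. \<exists>u. factor x u \<and> length u = ?m \<and> return_word x u r}"
    using v by blast
  then have "length r \<le> longest_return x ?m"
    unfolding longest_return_def by (rule Max_ge[OF finite_return_lengths[OF ur]])
  then have "p < longest_return x ?m" using t(2) len by linarith
  with pS show ?thesis by (auto simp: S_def)
qed

section \<open>Counting occurrences in windows\<close>

definition window_count :: "(nat \<Rightarrow> 'a) \<Rightarrow> 'a list \<Rightarrow> nat \<Rightarrow> nat \<Rightarrow> nat" where
  "window_count x u j N = (\<Sum>i<N. of_bool (subword x (j + i) (j + i + length u) = u))"

lemma prefix_frequency_window_count: "prefix_frequency x u N = window_count x u 0 N / N"
proof -
  have "{i. i < N \<and> subword x i (i + length u) = u} = {..<N} \<inter> {i. subword x i (i + length u) = u}"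
    by auto
  then show ?thesis by (simp add: prefix_frequency_def window_count_def sum_of_bool_eq)
qed

lemma window_count_add: "window_count x u j (M + N) = window_count x u j M + window_count x u (j + M) N"
  by (induction N) (simp_all add: window_count_def add.assoc)

text \<open>An occurrence that begins in the window may overhang its end, but the factor of length
  \<open>N + length u\<close> at \<open>j\<close> determines the count. Checking finitely many
  windows thus checks all of them.\<close>

lemma window_count_early:
  fixes x :: "nat \<Rightarrow> 'a::finite"
  assumes "uniformly_recurrent x"
  shows "\<exists>p<longest_return x (N + length u). window_count x u j N = window_count x u p N"
proof -
  let ?v = "subword x j (j + (N + length u))"
  obtain p where p: "p < longest_return x (N + length u)" "subword x p (p + (N + length u)) = ?v"
    using first_occurrence_less_longest_return[OF assms factor_subword, of j "j + (N + length u)"] by auto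
  have "subword x (j + i) (j + i + length u) = subword x (p + i) (p + i + length u)" if "i < N" for i
    unfolding subword_eq_subword_iff
  proof (intro allI impI)
    fix k assume "k < length u"
    with p(2)[unfolded subword_eq_subword_iff, rule_format, of "i + k"] that
    show "x (j + i + k) = x (p + i + k)" by (simp add: add.assoc)
  qed
  then have "window_count x u j N = window_count x u p N"
    by (auto simp: window_count_def intro!: sum.cong)
  with p(1) show ?thesis by blast
qed

text \<open>Cut the window into \<open>k\<close> consecutive windows of length \<open>N\<close> and
  add up their errors.\<close>

lemma window_count_dense:
  assumes "\<And>j. \<bar>real (window_count x u j N) - c\<bar> \<le> D"
  shows "\<bar>real (window_count x u j (k * N)) - k * c\<bar> \<le> k * D"
proof (induction k)
  case (Suc k)
  have "window_count x u j (Suc k * N) = window_count x u j (k * N) + window_count x u (j + k * N) N"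
    using window_count_add[of x u j "k * N" N] by (simp add: add.commute)
  then show ?case using Suc assms[of "j + k * N"] by (simp add: algebra_simps)
qed (simp add: window_count_def)

text \<open>The certificate behind the search: let the prefix length tend to infinity through the
  multiples of \<open>N\<close>, where \<open>window_count_dense\<close> applies.\<close>

lemma frequency_bound:
  assumes lim: "prefix_frequency x u \<longlonglongrightarrow> f" and N: "0 < N"
    and D: "\<And>j. \<bar>real (window_count x u j N) - c\<bar> \<le> D"
  shows "\<bar>f - c / N\<bar> \<le> D / N"
proof -
  have "filterlim (\<lambda>k. k * N) sequentially sequentially"
    by (rule filterlim_at_top_mono[OF filterlim_ident]) (use N in simp)
  then have "(\<lambda>k. \<bar>prefix_frequency x u (k * N) - c / N\<bar>) \<longlonglongrightarrow> \<bar>f - c / N\<bar>"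
    by (intro tendsto_intros filterlim_compose[OF lim])
  moreover have "\<bar>prefix_frequency x u (k * N) - c / N\<bar> \<le> D / N" if "k > 0" for k
  proof -
    have "prefix_frequency x u (k * N) - c / N = (real (window_count x u 0 (k * N)) - k * c) / (k * N)"
      using that N by (simp add: prefix_frequency_window_count field_simps)
    also have "\<bar>\<dots>\<bar> \<le> (k * D) / (k * N)"
      unfolding abs_divide abs_of_nat using window_count_dense[OF D, of 0 k] by (intro divide_right_mono) auto
    finally show ?thesis using that by simp
  qed
  ultimately show ?thesis
    by (intro tendsto_upperbound[where F=sequentially]) (auto intro: eventually_sequentiallyI[of 1])
qed

text \<open>The denominator is at most \<open>d + 1\<close> in absolute value, since the components
  of a pair do not exceed its code. This spares the machine any rational arithmetic on the
  tolerance.\<close>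

lemma inverse_le_nat_to_rat_surj:
  assumes "0 < nat_to_rat_surj d"
  shows "1 / real (Suc d) \<le> of_rat (nat_to_rat_surj d)"
proof -
  obtain a b where ab: "prod_decode d = (a, b)" by force
  have q: "nat_to_rat_surj d = Fract (int_decode a) (int_decode b)"
    by (simp add: nat_to_rat_surj_def ab)
  \<comment> \<open>\<open>Fract\<close> with denominator 0 is 0, which positivity excludes.\<close>
  have b0: "int_decode b \<noteq> 0" using assms unfolding q by (auto simp: rat_number_collapse)
  have r: "of_rat (nat_to_rat_surj d) = real_of_int (int_decode a) / real_of_int (int_decode b)"
    unfolding q using b0 by (simp add: of_rat_rat)
  have pos: "0 < real_of_int (int_decode a) / real_of_int (int_decode b)"
    unfolding r[symmetric] using assms by simp
  then have "int_decode a \<noteq> 0" by auto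
  then have a1: "1 \<le> \<bar>real_of_int (int_decode a)\<bar>" by linarith
  have "b \<le> d" by (metis ab le_prod_encode_2 prod_decode_inverse)
  moreover have "\<bar>int_decode b\<bar> \<le> int b + 1"
    by (auto simp: int_decode_def sum_decode_def split: sum.splits)
  ultimately have "\<bar>real_of_int (int_decode b)\<bar> \<le> real (Suc d)" by linarith
  then have "1 / real (Suc d) \<le> 1 / \<bar>real_of_int (int_decode b)\<bar>"
    using b0 by (intro divide_left_mono) auto
  also have "\<dots> \<le> \<bar>real_of_int (int_decode a)\<bar> / \<bar>real_of_int (int_decode b)\<bar>"
    using a1 by (rule divide_right_mono) simp
  also have "\<dots> = real_of_int (int_decode a) / real_of_int (int_decode b)"
    using pos by (metis abs_divide abs_of_pos)
  finally show ?thesis by (simp add: r)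
qed

text \<open>A natural number \<open>n\<close>, as an integer, has the code \<open>2 n\<close>.\<close>

lemma nat_to_rat_surj_pair_double: "nat_to_rat_surj (pair (c + c) (N + N)) = Fract (int c) (int N)"
  by (simp add: nat_to_rat_surj_def pair_def int_decode_def sum_decode_def flip: mult_2)

section \<open>Effective coding and counting of factors\<close>

definition word_code :: "(nat \<Rightarrow> 'a::countable) \<Rightarrow> nat \<Rightarrow> nat \<Rightarrow> nat" where
  "word_code x i l = list_encode (map to_nat (subword x i (i + l)))"

text \<open>\<open>list_encode\<close> builds a code from the tail, so the recursion reads the
  factor backwards from its last letter.\<close>

lemma computable_word_code:
  assumes "computable (\<lambda>n. to_nat (x n))" "computable i" "computable l"
  shows "computable (\<lambda>z. word_code x (i z) (l z))"
proof -
  have rec: "rec_nat 0 (\<lambda>k r. Suc (pair (to_nat (x (a + b - Suc k))) r)) n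
      = list_encode (map to_nat (subword x (a + b - n) (a + b)))" if "n \<le> b" for a b n
    using that
  proof (induction n)
    case (Suc n)
    then have "[a + b - Suc n..<a + b] = (a + b - Suc n) # [a + b - n..<a + b]"
      by (simp add: upt_conv_Cons Suc_diff_Suc)
    with Suc show ?case by (simp add: subword_def pair_def)
  qed (simp add: subword_def)
  note comp = computable_comp[OF assms(2) computable_pair_fst'] computable_comp[OF assms(3) computable_pair_fst']
  have "computable (\<lambda>p. i (pair_fst p) + l (pair_fst p) - Suc (pair_fst (pair_snd p)))"
    by (intro computable_diff computable_add comp computable_Suc computable_pair_fst computable_pair_snd computable_id)
  from computable_comp[OF assms(1) this]
  have "computable (\<lambda>z. rec_nat 0 (\<lambda>k r. Suc (pair (to_nat (x (i z + l z - Suc k))) r)) (l z))"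
    by (intro computable_rec_nat[where h="\<lambda>z k r. Suc (pair (to_nat (x (i z + l z - Suc k))) r)"]
        assms(3) computable_const computable_Suc computable_pair)
       (assumption | intro computable_pair_snd computable_id)+
  then show ?thesis by (simp add: rec word_code_def)
qed

text \<open>Equal codes force equal lengths; this is how the search recovers the length of
  \<open>u\<close> from its code.\<close>

lemma word_code_eq_iff:
  "word_code x i l = list_encode (map to_nat u) \<longleftrightarrow> l = length u \<and> subword x i (i + length u) = u"
proof -
  have "word_code x i l = list_encode (map to_nat u) \<longleftrightarrow> subword x i (i + l) = u"
    unfolding word_code_def by (simp add: list_encode_eq inj_map_eq_map[OF inj_to_nat])
  also have "\<dots> \<longleftrightarrow> l = length u \<and> subword x i (i + length u) = u"
    by (metis add_diff_cancel_left' length_subword)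
  finally show ?thesis .
qed

definition code_count :: "(nat \<Rightarrow> 'a::countable) \<Rightarrow> nat \<Rightarrow> nat \<Rightarrow> nat \<Rightarrow> nat \<Rightarrow> nat" where
  "code_count x w l N j = (\<Sum>i<N. of_bool (word_code x (j + i) l = w))"

lemma code_count_eq: "code_count x (list_encode (map to_nat u)) (length u) N j = window_count x u j N"
  by (simp add: code_count_def window_count_def word_code_eq_iff)

lemma computable_code_count:
  assumes "computable (\<lambda>n. to_nat (x n))" "computable w" "computable l" "computable N" "computable j"
  shows "computable (\<lambda>z. code_count x (w z) (l z) (N z) (j z))"
  unfolding code_count_def
  by (rule computable_sum[where f="\<lambda>z i. of_bool (word_code x (j z + i) (l z) = w z)", OF assms(4)])
     (intro computable_eq computable_word_code[OF assms(1)] computable_add computable_pair_snd computable_id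
       assms(2-5)[THEN computable_comp, OF computable_pair_fst'])

theorem computable_frequencies_of_uniform:
  fixes x :: "nat \<Rightarrow> 'a::finite"
  assumes eur: "effectively_uniformly_recurrent x"
    and f: "\<And>u \<epsilon>. \<epsilon> > 0 \<Longrightarrow> \<forall>\<^sub>F N in sequentially. \<forall>j. \<bar>window_count x u j N / N - f u\<bar> < \<epsilon>"
  shows "admits_computable_factor_frequencies x"
proof -
  have ur: "uniformly_recurrent x" and X: "computable (\<lambda>n. to_nat (x n))" and R: "computable (longest_return x)"
    using eur by (auto simp: effectively_uniformly_recurrent_def)
  have lim: "prefix_frequency x u \<longlonglongrightarrow> f u" for u
    unfolding tendsto_iff
  proof (intro allI impI)
    fix \<epsilon> :: real assume "\<epsilon> > 0"
    from f[OF this, of u] show "\<forall>\<^sub>F N in sequentially. dist (prefix_frequency x u N) (f u) < \<epsilon>"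
      by eventually_elim (simp add: prefix_frequency_window_count dist_real_def)
  qed
  then have freq: "factor_frequency x u = f u" for u
    by (simp add: factor_frequency_def limI)
  \<comment> \<open>The search is over triples of an occurrence \<open>i\<close> of \<open>u\<close>, its length \<open>l\<close> and a window length \<open>N\<close>;
    by \<open>inverse_le_nat_to_rat_surj\<close>, the tolerance coded by \<open>d\<close> may be replaced by \<open>1 / (d + 1)\<close>.\<close>
  define w d i l N where
    "w = (\<lambda>p. pair_fst (pair_fst p))" and "d = (\<lambda>p. pair_snd (pair_fst p))"
    and "i = (\<lambda>p. pair_fst (pair_snd p))" and "l = (\<lambda>p. pair_fst (pair_snd (pair_snd p)))"
    and "N = (\<lambda>p. pair_snd (pair_snd (pair_snd p)))"
  define c where "c = (\<lambda>p. code_count x (w p) (l p) (N p))"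
  \<comment> \<open>\<open>Q\<close> counts violated conditions, so it vanishes exactly on the
    wanted triples. The two truncated differences add up to the absolute difference.\<close>
  define Q where "Q = (\<lambda>p. of_bool (word_code x (i p) (l p) \<noteq> w p) +
    (\<Sum>j<longest_return x (N p + l p). of_bool (N p \<le> ((c p j - c p 0) + (c p 0 - c p j)) * Suc (d p)) :: nat))"
  define G where "G = (\<lambda>p. pair (c p 0 + c p 0) (N p + N p))"
  have coord: "computable w" "computable d" "computable i" "computable l" "computable N"
    unfolding w_def d_def i_def l_def N_def
    by (intro computable_pair_fst computable_pair_snd computable_id)+
  note lifted = coord[THEN computable_comp, OF computable_pair_fst']
  have c0: "computable (\<lambda>p. c p 0)"
    unfolding c_def by (intro computable_code_count X coord computable_const)
  have cj: "computable (\<lambda>p. c (pair_fst p) (pair_snd p))"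
    unfolding c_def by (intro computable_code_count X lifted computable_pair_snd computable_id)
  have R': "computable (\<lambda>p. longest_return x (N p + l p))"
    by (rule computable_comp[OF R]) (intro computable_add coord)
  note c0' = computable_comp[OF c0 computable_pair_fst']
  have "computable (\<lambda>p. of_bool (N (pair_fst p) \<le>
      ((c (pair_fst p) (pair_snd p) - c (pair_fst p) 0) + (c (pair_fst p) 0 - c (pair_fst p) (pair_snd p))) * Suc (d (pair_fst p))))"
    by (rule computable_le[OF lifted(5) computable_mult[OF
        computable_add[OF computable_diff[OF cj c0'] computable_diff[OF c0' cj]] computable_Suc[OF lifted(2)]]])
  note computable_sum[where f="\<lambda>p j. of_bool (N p \<le> ((c p j - c p 0) + (c p 0 - c p j)) * Suc (d p))", OF R' this]
  then have "computable Q"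
    unfolding Q_def by (rule computable_add[OF computable_neq[OF computable_word_code[OF X coord(3,4)] coord(1)]])
  moreover have "computable G"
    unfolding G_def by (intro computable_pair computable_add c0 coord)
  ultimately obtain M where M: "turing_machine_wf M"
    "\<And>a b z. Q (pair (pair a b) z) = 0 \<Longrightarrow>
       \<exists>z. Q (pair (pair a b) z) = 0 \<and> tm_computes M [a, b] (G (pair (pair a b) z))"
    by (rule machine_search) blast
  have Q0: "Q (pair (pair (list_encode (map to_nat u)) e) (pair k (pair n m))) = 0 \<longleftrightarrow>
      n = length u \<and> subword x k (k + n) = u \<and>
      (\<forall>j<longest_return x (m + n). \<bar>real (window_count x u j m) - window_count x u 0 m\<bar> * Suc e < m)" for u e k n m
  proof -
    have abs: "\<bar>real a - real b\<bar> = real ((a - b) + (b - a))" for a b :: nat by auto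
    have lt: "real a * real b < real m \<longleftrightarrow> \<not> m \<le> a * b" for a b
      by (metis not_le of_nat_less_iff of_nat_mult)
    show ?thesis
      unfolding Q_def c_def abs lt
      by (auto simp: w_def d_def i_def l_def N_def word_code_eq_iff code_count_eq simp del: mult_Suc_right)
  qed
  have "\<exists>r. tm_computes M [list_encode (map to_nat u), e] r \<and>
          \<bar>factor_frequency x u - of_rat (nat_to_rat_surj r)\<bar> < of_rat (nat_to_rat_surj e)"
    if u: "factor x u" and e: "nat_to_rat_surj e > 0" for u e
  proof -
    let ?w = "list_encode (map to_nat u)"
    obtain k j where "k \<le> j" "u = subword x k j"
      using u by (auto simp: factor_def)
    then have k: "subword x k (k + length u) = u" by simp
    \<comment> \<open>Half the tolerance, because two windows are compared through
      \<open>f u\<close>.\<close>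
    have "\<forall>\<^sub>F N in sequentially. \<forall>j. \<bar>window_count x u j N / N - f u\<bar> < 1 / (2 * Suc e)"
      by (rule f) simp
    then have "\<forall>\<^sub>F N in sequentially. N > 0 \<and> (\<forall>j. \<bar>window_count x u j N / N - f u\<bar> < 1 / (2 * Suc e))"
      using eventually_gt_at_top[of 0] by eventually_elim simp
    then obtain m where m: "m > 0" "\<And>j. \<bar>window_count x u j m / m - f u\<bar> < 1 / (2 * Suc e)"
      by (metis (mono_tags, lifting) eventually_sequentially order_refl)
    have "\<bar>real (window_count x u j m) - window_count x u 0 m\<bar> * Suc e < m" for j
    proof -
      have "\<bar>window_count x u j m / m - window_count x u 0 m / m\<bar> < 2 * (1 / (2 * Suc e))"
        using m(2)[of j] m(2)[of 0] by linarith
      also have "window_count x u j m / m - window_count x u 0 m / m = (real (window_count x u j m) - window_count x u 0 m) / m"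
        by (simp add: diff_divide_distrib)
      also have "2 * (1 / (2 * Suc e)) = 1 / real (Suc e)"
        by (simp add: field_simps)
      finally have "\<bar>real (window_count x u j m) - window_count x u 0 m\<bar> / m < 1 / Suc e"
        by simp
      then show ?thesis using m(1) by (simp add: field_simps del: of_nat_Suc)
    qed
    then have "Q (pair (pair ?w e) (pair k (pair (length u) m))) = 0"
      using k by (simp add: Q0)
    from M(2)[OF this] obtain z where z: "Q (pair (pair ?w e) z) = 0" "tm_computes M [?w, e] (G (pair (pair ?w e) z))"
      by blast
    obtain k' n m where zz: "z = pair k' (pair n m)"
      by (metis pair_def prod_decode_inverse surj_pair)
    have n: "n = length u" and early: "\<And>j. j < longest_return x (m + n) \<Longrightarrow>
        \<bar>real (window_count x u j m) - window_count x u 0 m\<bar> * Suc e < m"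
      using z(1) unfolding zz Q0 by auto
    have all: "\<bar>real (window_count x u j m) - window_count x u 0 m\<bar> * Suc e < m" for j
      using window_count_early[OF ur, of m u j] early n by metis
    \<comment> \<open>At \<open>j = 0\<close> the left-hand side is 0, so the strict test rules out
      empty windows.\<close>
    have m0: "0 < m" using all[of 0] by simp
    \<comment> \<open>Limits preserve only weak inequalities. Integrality sharpens
      \<open>< m\<close> to \<open>m - 1\<close>, which leaves room for the strict bound at the
      end.\<close>
    have "\<bar>real (window_count x u j m) - window_count x u 0 m\<bar> \<le> (real m - 1) / Suc e" for j
    proof -
      have "\<bar>int (window_count x u j m) - window_count x u 0 m\<bar> * Suc e < m"
        using all[of j] by (metis (mono_tags, lifting) of_int_abs of_int_diff of_int_less_iff of_int_mult of_int_of_nat_eq)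
      then have "\<bar>int (window_count x u j m) - window_count x u 0 m\<bar> * Suc e \<le> int m - 1" by linarith
      then have "real_of_int (\<bar>int (window_count x u j m) - window_count x u 0 m\<bar> * Suc e) \<le> real_of_int (int m - 1)"
        by (simp only: of_int_le_iff)
      then show ?thesis by (simp add: pos_le_divide_eq del: of_nat_Suc)
    qed
    from frequency_bound[OF lim m0 this]
    have "\<bar>f u - window_count x u 0 m / m\<bar> \<le> (real m - 1) / Suc e / m" .
    also have "\<dots> = (real m - 1) / m / Suc e" by (simp add: mult.commute)
    also have "\<dots> < 1 / Suc e" using m0 by (intro divide_strict_right_mono) simp_all
    also have "\<dots> \<le> of_rat (nat_to_rat_surj e)" using e by (rule inverse_le_nat_to_rat_surj)
    finally have "\<bar>f u - window_count x u 0 m / m\<bar> < of_rat (nat_to_rat_surj e)" .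
    moreover have "of_rat (nat_to_rat_surj (G (pair (pair ?w e) z))) = real (window_count x u 0 m) / m"
      using m0 by (simp add: G_def c_def zz w_def l_def N_def n code_count_eq nat_to_rat_surj_pair_double of_rat_rat)
    ultimately show ?thesis using z(2) freq by (metis (no_types))
  qed
  moreover have "admits_factor_frequencies x"
    using lim by (auto simp: admits_factor_frequencies_def convergent_def)
  ultimately show ?thesis
    unfolding admits_computable_factor_frequencies_def using M(1) by blast
qed

section \<open>Unique ergodicity and uniform frequencies\<close>

text \<open>The index type is uncountable below, so a cluster point in the product replaces a diagonal
  subsequence.\<close>

lemma limit_along_filter:
  fixes F :: "nat \<Rightarrow> 's \<Rightarrow> real"
  assumes "\<And>k a. F k a \<in> {0..1}"
  obtains H f where "H \<noteq> bot" "H \<le> sequentially" "\<And>a. ((\<lambda>k. F k a) \<longlongrightarrow> f a) H"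
proof -
  have "compactin (product_topology (\<lambda>_. euclidean) UNIV) (PiE UNIV (\<lambda>_ :: 's. {0..1 :: real}))"
    unfolding compactin_PiE by simp
  then have cp: "compact (PiE UNIV (\<lambda>_ :: 's. {0..1 :: real}))"
    unfolding euclidean_product_topology by simp
  have "filtermap F sequentially \<noteq> bot" by (simp add: filtermap_bot_iff)
  moreover have "\<forall>\<^sub>F y in filtermap F sequentially. y \<in> PiE UNIV (\<lambda>_. {0..1})"
    using assms by (simp add: eventually_filtermap PiE_iff)
  ultimately obtain f where f: "inf (nhds f) (filtermap F sequentially) \<noteq> bot"
    using cp unfolding compact_filter by blast
  \<comment> \<open>\<open>H\<close> restricts to large \<open>k\<close> with \<open>F k\<close>
    near \<open>f\<close>; it is proper because \<open>f\<close> is a cluster point.\<close>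
  define H where "H = inf (filtercomap F (nhds f)) sequentially"
  have "H \<noteq> bot"
  proof
    assume "H = bot"
    then have "eventually (\<lambda>_. False) H" by simp
    then obtain P Q where PQ: "eventually P (nhds f)" "eventually Q sequentially" "\<And>k. P (F k) \<Longrightarrow> Q k \<Longrightarrow> False"
      unfolding H_def eventually_inf eventually_filtercomap by blast
    have "eventually (\<lambda>y. \<exists>k. Q k \<and> y = F k) (filtermap F sequentially)"
      unfolding eventually_filtermap using PQ(2) by eventually_elim blast
    with PQ have "eventually (\<lambda>_. False) (inf (nhds f) (filtermap F sequentially))"
      unfolding eventually_inf by blast
    with f show False by (simp add: trivial_limit_def)
  qed
  moreover have "H \<le> sequentially" by (simp add: H_def)
  moreover have "filterlim F (nhds f) H"
    unfolding H_def by (rule filterlim_mono[OF filterlim_filtercomap order_refl]) simp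
  then have "((\<lambda>k. F k a) \<longlongrightarrow> f a) H" for a
    by (rule continuous_on_tendsto_compose[OF continuous_on_product_coordinates]) simp_all
  ultimately show ?thesis by (rule that)
qed

section \<open>Cylinders and compactness of the full shift\<close>

definition cylinder :: "'a list \<Rightarrow> (nat \<Rightarrow> 'a) set" where
  "cylinder v = {y. \<forall>k<length v. y k = v ! k}"

lemma open_cylinder: "open (cylinder (v :: 'a::discrete_topology list))"
proof -
  have "open {y. \<forall>k\<in>{..<length v}. y k \<in> {v ! k}}"
    by (rule product_topology_basis') (simp_all add: discrete_topology_class.open_discrete)
  then show ?thesis by (simp add: cylinder_def Ball_def)
qed

lemma closed_cylinder: "closed (cylinder (v :: 'a::discrete_topology list))"
  unfolding cylinder_def
  by (intro closed_Collect_all closed_Collect_imp closed_Collect_eq open_Collect_const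
      continuous_on_product_coordinates continuous_on_const)

lemma cylinder_basis:
  fixes U :: "(nat \<Rightarrow> 'a::discrete_topology) set"
  assumes "open U" "y \<in> U"
  shows "\<exists>v. y \<in> cylinder v \<and> cylinder v \<subseteq> U"
proof -
  have "openin (product_topology (\<lambda>_ :: nat. euclidean) UNIV) U"
    using assms(1) by (simp add: euclidean_product_topology)
  from product_topology_open_contains_basis[OF this assms(2)] obtain X where
    X: "y \<in> PiE UNIV X" "finite {i. X i \<noteq> UNIV}" "PiE UNIV X \<subseteq> U" by auto
  obtain n where n: "\<And>i. X i \<noteq> UNIV \<Longrightarrow> i < n"
    using X(2) unfolding finite_nat_set_iff_bounded by blast
  have "cylinder (map y [0..<n]) \<subseteq> PiE UNIV X"
  proof
    fix z assume z: "z \<in> cylinder (map y [0..<n])"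
    have "z i \<in> X i" for i
    proof (cases "i < n")
      case True
      then show ?thesis using z X(1) by (auto simp: cylinder_def PiE_iff)
    next
      case False
      then show ?thesis using n[of i] by auto
    qed
    then show "z \<in> PiE UNIV X" by auto
  qed
  moreover have "y \<in> cylinder (map y [0..<n])" by (simp add: cylinder_def)
  ultimately show ?thesis using X(3) by blast
qed

lemma borel_eq_cylinders:
  "(borel :: (nat \<Rightarrow> 'a::{discrete_topology, countable}) measure) = sigma UNIV (range cylinder)"
  by (rule borel_eq_countable_basis)
     (auto intro!: topological_basisI simp: open_cylinder dest: cylinder_basis)

lemma compact_UNIV_words: "compact (UNIV :: (nat \<Rightarrow> 'a::{finite, discrete_topology}) set)"
proof -
  have "compactin (product_topology (\<lambda>_. euclidean) UNIV) (PiE UNIV (\<lambda>_ :: nat. UNIV :: 'a set))"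
    unfolding compactin_PiE by (simp add: finite_imp_compact)
  then show ?thesis
    unfolding euclidean_product_topology by simp
qed

text \<open>By compactness. It makes the continuity at the empty set required by Caratheodory's
  theorem immediate: the sequence is eventually empty.\<close>

lemma decseq_closed_empty:
  fixes A :: "nat \<Rightarrow> (nat \<Rightarrow> 'a::{finite, discrete_topology}) set"
  assumes "decseq A" "\<And>i. closed (A i)" "(\<Inter>i. A i) = {}"
  shows "\<exists>i. A i = {}"
proof (rule ccontr)
  assume ne: "\<nexists>i. A i = {}"
  have "UNIV \<inter> \<Inter>(range A) \<noteq> {}"
  proof (rule compact_fip[THEN iffD1, OF compact_UNIV_words, rule_format])
    show "closed a" if "a \<in> range A" for a using that assms(2) by auto
    fix B assume "B \<subseteq> range A" "finite B"
    then obtain I where I: "finite I" "B = A ` I" by (meson finite_subset_image)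
    obtain n where "\<And>i. i \<in> I \<Longrightarrow> i \<le> n" using I(1) by (meson finite_nat_set_iff_bounded_le)
    then have "A n \<subseteq> \<Inter>B" using assms(1) by (auto simp: I(2) decseq_def dest: subsetD)
    then show "UNIV \<inter> \<Inter>B \<noteq> {}" using ne by auto
  qed
  with assms(3) show False by simp
qed

section \<open>The generated shift and its clopen algebra\<close>

lemma funpow_shift_map: "(shift_map ^^ n) x = (\<lambda>k. x (n + k))"
  by (induction n) (auto simp: shift_map_def)

lemma continuous_shift_map: "continuous_on S (shift_map :: (nat \<Rightarrow> 'a::topological_space) \<Rightarrow> _)"
  unfolding shift_map_def
  by (intro continuous_on_coordinatewise_then_product)
     (rule continuous_on_subset[OF continuous_on_product_coordinates subset_UNIV])

lemma closed_generated_shift: "closed (generated_shift x)"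
  by (simp add: generated_shift_def)

lemma orbit_in_generated_shift: "(shift_map ^^ n) x \<in> generated_shift x"
  unfolding generated_shift_def by (rule subsetD[OF closure_subset]) auto

lemma shift_map_generated_shift: "y \<in> generated_shift x \<Longrightarrow> shift_map y \<in> generated_shift x"
proof -
  have "shift_map ` closure {(shift_map ^^ n) x | n. True} \<subseteq> generated_shift x"
  proof (rule image_closure_subset[OF continuous_shift_map closed_generated_shift], safe)
    show "shift_map ((shift_map ^^ n) x) \<in> generated_shift x" for n
      using orbit_in_generated_shift[of "Suc n" x] by simp
  qed
  then show "y \<in> generated_shift x \<Longrightarrow> shift_map y \<in> generated_shift x"
    by (auto simp: generated_shift_def)
qed

text \<open>Traces of clopen sets rather than of cylinders, because they are closed under complement
  and form an algebra.\<close>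

definition clopen_in :: "(nat \<Rightarrow> 'a::discrete_topology) set \<Rightarrow> (nat \<Rightarrow> 'a) set set" where
  "clopen_in X = {A \<inter> X | A. open A \<and> closed A}"

lemma algebra_clopen_in: "algebra X (clopen_in X)"
  unfolding algebra_iff_Int
proof (intro conjI ballI)
  show "clopen_in X \<subseteq> Pow X" by (auto simp: clopen_in_def)
  show "{} \<in> clopen_in X" unfolding clopen_in_def by (rule CollectI, rule exI[of _ "{}"]) simp
next
  fix A assume "A \<in> clopen_in X"
  then obtain A' where A': "A = A' \<inter> X" "open A'" "closed A'" by (auto simp: clopen_in_def)
  show "X - A \<in> clopen_in X"
    unfolding clopen_in_def by (rule CollectI, rule exI[of _ "- A'"]) (use A' in auto)
  fix B assume "B \<in> clopen_in X"
  then obtain B' where B': "B = B' \<inter> X" "open B'" "closed B'" by (auto simp: clopen_in_def)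
  show "A \<inter> B \<in> clopen_in X"
    unfolding clopen_in_def by (rule CollectI, rule exI[of _ "A' \<inter> B'"]) (use A' B' in auto)
qed

lemma sets_restrict_borel_clopen_in:
  fixes X :: "(nat \<Rightarrow> 'a::{finite, discrete_topology}) set"
  assumes "closed X"
  shows "sets (restrict_space borel X) = sigma_sets X (clopen_in X)"
proof -
  have X: "X \<in> sigma_sets UNIV {A. open A \<and> closed A}"
    and b: "sets (borel :: (nat \<Rightarrow> 'a) measure) = sigma_sets UNIV {A. open A \<and> closed A}"
  proof -
    have "sets (borel :: (nat \<Rightarrow> 'a) measure) = sigma_sets UNIV (range cylinder)"
      by (simp add: borel_eq_cylinders)
    also have "\<dots> \<subseteq> sigma_sets UNIV {A. open A \<and> closed A}"
      by (rule sigma_sets_mono') (auto intro: open_cylinder closed_cylinder)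
    moreover have "sigma_sets UNIV {A. open A \<and> closed A} \<subseteq> sets (borel :: (nat \<Rightarrow> 'a) measure)"
      using sets.sigma_sets_subset[of "{A. open A \<and> closed A}" "borel :: (nat \<Rightarrow> 'a) measure"]
      by (auto intro: borel_open)
    ultimately show *: "sets (borel :: (nat \<Rightarrow> 'a) measure) = sigma_sets UNIV {A. open A \<and> closed A}"
      by auto
    show "X \<in> sigma_sets UNIV {A. open A \<and> closed A}"
      using borel_closed[OF assms] unfolding * .
  qed
  have "(\<inter>) X ` {A. open A \<and> closed A} = clopen_in X"
    by (auto simp: clopen_in_def)
  then show ?thesis
    unfolding sets_restrict_space b using sigma_sets_Int[OF X] by simp
qed

text \<open>\<open>\<kappa>\<close> is a finitely additive invariant set function on all sets, of
  the kind a Banach limit yields, and need not be countably additive. Its restriction to the clopen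
  traces is a premeasure, and only these values survive in the extension.\<close>

theorem invariant_measure_of_content:
  fixes x :: "nat \<Rightarrow> 'a::{finite, discrete_topology}"
  defines "X \<equiv> generated_shift x"
  assumes nonneg: "\<And>A. 0 \<le> \<kappa> A" and empty: "\<kappa> {} = 0" and full: "\<kappa> X = 1"
    and add: "\<And>A B. A \<inter> B = {} \<Longrightarrow> \<kappa> (A \<union> B) = \<kappa> A + (\<kappa> B :: real)"
    and inv: "\<And>A. \<kappa> (shift_map -` A \<inter> X) = \<kappa> A"
  obtains \<nu> where "invariant_measure X \<nu>" "\<And>A. A \<in> clopen_in X \<Longrightarrow> measure \<nu> A = \<kappa> A"
proof -
  have clX: "closed X" by (simp add: X_def closed_generated_shift)
  have alg: "algebra X (clopen_in X)" by (rule algebra_clopen_in)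
  have "\<exists>m :: (nat \<Rightarrow> 'a) set \<Rightarrow> ennreal. (\<forall>s \<in> clopen_in X. m s = ennreal (\<kappa> s)) \<and> measure_space X (sigma_sets X (clopen_in X)) m"
  proof (rule ring_of_sets.caratheodory_empty_continuous[OF algebra.axioms(1)[OF alg], where f="\<lambda>s. ennreal (\<kappa> s)"])
    show "positive (clopen_in X) (\<lambda>s. ennreal (\<kappa> s))" by (simp add: positive_def empty)
    show "additive (clopen_in X) (\<lambda>s. ennreal (\<kappa> s))"
      by (simp add: additive_def add nonneg)
    fix A :: "nat \<Rightarrow> (nat \<Rightarrow> 'a) set"
    assume A: "range A \<subseteq> clopen_in X" "decseq A" "(\<Inter>i. A i) = {}"
    have "closed (A i)" for i
    proof -
      have "A i \<in> clopen_in X" using A(1) by auto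
      then obtain B where "A i = B \<inter> X" "closed B" unfolding clopen_in_def by blast
      then show ?thesis using clX by (simp add: closed_Int)
    qed
    with A(2,3) have "\<exists>n. A n = {}" by (intro decseq_closed_empty)
    then obtain n where "A n = {}" ..
    then have "A i = {}" if "n \<le> i" for i
      using A(2) that by (auto simp: decseq_def)
    then have "\<forall>\<^sub>F i in sequentially. ennreal (\<kappa> (A i)) = 0"
      by (intro eventually_sequentiallyI[of n]) (simp add: empty)
    then show "(\<lambda>i. ennreal (\<kappa> (A i))) \<longlonglongrightarrow> 0"
      by (rule tendsto_eventually)
  qed simp
  then obtain m where m: "\<And>s. s \<in> clopen_in X \<Longrightarrow> m s = ennreal (\<kappa> s)"
    "measure_space X (sigma_sets X (clopen_in X)) m" by blast
  define \<nu> where "\<nu> = measure_of X (clopen_in X) m"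
  have pow: "clopen_in X \<subseteq> Pow X" by (auto simp: clopen_in_def)
  have sp: "space \<nu> = X" and se: "sets \<nu> = sigma_sets X (clopen_in X)"
    using pow by (simp_all add: \<nu>_def)
  have em: "emeasure \<nu> A = m A" if "A \<in> sigma_sets X (clopen_in X)" for A
    by (rule emeasure_measure_of[OF \<nu>_def pow]) (use m(2) that in \<open>auto simp: se measure_space_def\<close>)
  have em': "emeasure \<nu> A = ennreal (\<kappa> A)" if "A \<in> clopen_in X" for A
    using em[of A] m(1)[OF that] that by auto
  have Xin: "X \<in> clopen_in X" by (rule algebra.top[OF alg])
  have prob: "prob_space \<nu>"
    by (rule prob_spaceI) (simp add: sp em'[OF Xin] full)
  have pre: "shift_map -` A \<inter> X \<in> clopen_in X" if "A \<in> clopen_in X" for A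
  proof -
    obtain A' where A': "A = A' \<inter> X" "open A'" "closed A'" using \<open>A \<in> clopen_in X\<close> by (auto simp: clopen_in_def)
    have "shift_map -` A \<inter> X = shift_map -` A' \<inter> X"
      using shift_map_generated_shift by (auto simp: A'(1) X_def)
    moreover have "open (shift_map -` A')" "closed (shift_map -` A')"
      using A' continuous_shift_map[of UNIV] by (auto intro: open_vimage closed_vimage)
    ultimately show ?thesis by (auto simp: clopen_in_def)
  qed
  have meas: "shift_map \<in> measurable \<nu> \<nu>"
    by (rule measurable_sigma_sets[OF se pow])
       (use shift_map_generated_shift pre in \<open>auto simp: sp se X_def\<close>)
  \<comment> \<open>Invariance is known on the clopen algebra only; as an intersection-stable
    generator, it determines the image measure on all Borel sets.\<close>
  have "\<nu> = distr \<nu> \<nu> shift_map"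
  proof (rule measure_eqI_generator_eq[where E="clopen_in X" and \<Omega>=X and A="\<lambda>_. X"])
    show "Int_stable (clopen_in X)" using alg by (auto simp: Int_stable_def algebra_iff_Int)
    show "emeasure \<nu> A = emeasure (distr \<nu> \<nu> shift_map) A" if A: "A \<in> clopen_in X" for A
      using A pre[OF A] by (subst emeasure_distr[OF meas]) (auto simp: se sp em' inv)
  qed (use pow Xin em' in \<open>auto simp: se\<close>)
  then have "emeasure \<nu> (shift_map -` B \<inter> X) = emeasure \<nu> B" if "B \<in> sets \<nu>" for B
    using emeasure_distr[OF meas that] sp by simp
  then have "invariant_measure X \<nu>"
    by (simp add: invariant_measure_def sp se prob sets_restrict_borel_clopen_in[OF clX])
  moreover have "measure \<nu> A = \<kappa> A" if "A \<in> clopen_in X" for A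
    by (simp add: measure_def em'[OF that] nonneg)
  ultimately show ?thesis by (rule that)
qed

section \<open>Empirical distributions along the orbit\<close>

definition visits :: "(nat \<Rightarrow> 'a) \<Rightarrow> nat \<Rightarrow> nat \<Rightarrow> (nat \<Rightarrow> 'a) set \<Rightarrow> real" where
  "visits x j N A = (\<Sum>i<N. indicator A ((shift_map ^^ (j + i)) x)) / N"

lemma visits_cylinder: "visits x j N (cylinder u \<inter> generated_shift x) = window_count x u j N / N"
proof -
  have "(shift_map ^^ (j + i)) x \<in> cylinder u \<longleftrightarrow> subword x (j + i) (j + i + length u) = u" for i
    by (simp add: cylinder_def funpow_shift_map subword_eq_iff)
  then show ?thesis
    by (simp add: visits_def window_count_def indicator_def orbit_in_generated_shift of_bool_def if_distrib[of real] cong: if_cong)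
qed

text \<open>Pulling \<open>A\<close> back moves the window by one step, so the sums differ by two
  boundary terms, each 0 or 1.\<close>

lemma visits_shift:
  "\<bar>visits x j N (shift_map -` A \<inter> generated_shift x) - visits x j N A\<bar> \<le> 1 / N"
proof -
  let ?g = "\<lambda>i. indicator A ((shift_map ^^ (j + i)) x) :: real"
  have "indicator (shift_map -` A \<inter> generated_shift x) ((shift_map ^^ (j + i)) x) = ?g (Suc i)" for i
    using orbit_in_generated_shift[of "j + i" x] by (simp add: indicator_def)
  then have "visits x j N (shift_map -` A \<inter> generated_shift x) - visits x j N A = ((\<Sum>i<N. ?g (Suc i)) - (\<Sum>i<N. ?g i)) / N"
    by (simp add: visits_def diff_divide_distrib)
  also have "(\<Sum>i<N. ?g (Suc i)) - (\<Sum>i<N. ?g i) = ?g N - ?g 0"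
    unfolding sum_subtractf[symmetric] by (rule sum_lessThan_telescope)
  also have "\<bar>(?g N - ?g 0) / N\<bar> \<le> 1 / N"
    unfolding abs_divide abs_of_nat by (rule divide_right_mono) (auto simp: indicator_def)
  finally show ?thesis .
qed

theorem uniform_frequencies:
  fixes x :: "nat \<Rightarrow> 'a::{finite, discrete_topology}"
  assumes ue: "uniquely_ergodic (generated_shift x)" and \<mu>: "invariant_measure (generated_shift x) \<mu>"
    and "0 < (\<epsilon> :: real)"
  shows "\<forall>\<^sub>F N in sequentially. \<forall>j. \<bar>window_count x u j N / N - measure \<mu> (cylinder u \<inter> generated_shift x)\<bar> < \<epsilon>"
proof (rule ccontr)
  let ?X = "generated_shift x"
  define c where "c = measure \<mu> (cylinder u \<inter> ?X)"
  assume "\<not> ?thesis"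
  \<comment> \<open>\<open>Suc k\<close> keeps windows non-empty and sends the invariance defect
    \<open>1 / N\<close> to 0. The start \<open>j\<close> is left uncontrolled, whence the
    uniformity in \<open>j\<close>.\<close>
  then have "\<exists>N\<ge>Suc k. \<exists>j. \<epsilon> \<le> \<bar>visits x j N (cylinder u \<inter> ?X) - c\<bar>" for k
    by (auto simp: eventually_sequentially visits_cylinder c_def not_less)
  then have "\<forall>k. \<exists>p. Suc k \<le> fst p \<and> \<epsilon> \<le> \<bar>visits x (snd p) (fst p) (cylinder u \<inter> ?X) - c\<bar>"
    by force
  from choice[OF this] obtain p where
    p: "\<forall>k. Suc k \<le> fst (p k) \<and> \<epsilon> \<le> \<bar>visits x (snd (p k)) (fst (p k)) (cylinder u \<inter> ?X) - c\<bar>" ..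
  define N j where "N = fst \<circ> p" and "j = snd \<circ> p"
  have Nj: "Suc k \<le> N k" "\<epsilon> \<le> \<bar>visits x (j k) (N k) (cylinder u \<inter> ?X) - c\<bar>" for k
    using p by (simp_all add: N_def j_def)
  define F where "F = (\<lambda>k. visits x (j k) (N k))"
  have F01: "F k A \<in> {0..1}" for k A
  proof -
    have "(\<Sum>i<N k. indicator A ((shift_map ^^ (j k + i)) x)) \<le> (\<Sum>i<N k. 1 :: real)"
      by (rule sum_mono) (simp add: indicator_def)
    then show ?thesis using Nj(1)[of k] by (simp add: F_def visits_def sum_nonneg)
  qed
  obtain H \<kappa> where H: "H \<noteq> bot" "H \<le> sequentially" and lim: "\<And>A. ((\<lambda>k. F k A) \<longlongrightarrow> \<kappa> A) H"
    using limit_along_filter[of F, OF F01] by blast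
  have "invariant_measure ?X \<mu>' \<Longrightarrow> \<mu>' = \<mu>" for \<mu>'
    using ue \<mu> by (auto simp: uniquely_ergodic_def)
  moreover obtain \<nu> where \<nu>: "invariant_measure ?X \<nu>" "\<And>A. A \<in> clopen_in ?X \<Longrightarrow> measure \<nu> A = \<kappa> A"
  proof (rule invariant_measure_of_content)
    show "0 \<le> \<kappa> A" for A
      by (rule tendsto_lowerbound[OF lim _ H(1)]) (simp add: F_def visits_def sum_nonneg)
    show "\<kappa> {} = 0"
      by (rule tendsto_unique[OF H(1) lim]) (simp add: F_def visits_def)
    show "\<kappa> ?X = 1"
    proof (rule tendsto_unique[OF H(1) lim])
      have "F k ?X = 1" for k
        using Nj(1)[of k] by (simp add: F_def visits_def orbit_in_generated_shift)
      then show "((\<lambda>k. F k ?X) \<longlongrightarrow> 1) H" by simp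
    qed
    show "\<kappa> (A \<union> B) = \<kappa> A + \<kappa> B" if "A \<inter> B = {}" for A B
    proof (rule tendsto_unique[OF H(1) lim])
      have "F k (A \<union> B) = F k A + F k B" for k
        using that by (simp add: F_def visits_def indicator_add flip: sum.distrib add_divide_distrib)
      then show "((\<lambda>k. F k (A \<union> B)) \<longlongrightarrow> \<kappa> A + \<kappa> B) H"
        using tendsto_add[OF lim lim] by simp
    qed
    show "\<kappa> (shift_map -` A \<inter> ?X) = \<kappa> A" for A
    proof (rule tendsto_unique[OF H(1) lim])
      have "\<bar>F k (shift_map -` A \<inter> ?X) - F k A\<bar> \<le> 1 / Suc k" for k
        using visits_shift[of x "j k" "N k" A] Nj(1)[of k] frac_le[of 1 1 "Suc k" "N k"]
        by (simp add: F_def)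
      then have "((\<lambda>k. F k (shift_map -` A \<inter> ?X) - F k A) \<longlongrightarrow> 0) sequentially"
        by (intro Lim_null_comparison[OF _ LIMSEQ_inverse_real_of_nat] always_eventually) (simp add: inverse_eq_divide)
      then have "((\<lambda>k. F k (shift_map -` A \<inter> ?X) - F k A) \<longlongrightarrow> 0) H"
        by (rule tendsto_mono[OF H(2)])
      from tendsto_add[OF this lim[of A]] show "((\<lambda>k. F k (shift_map -` A \<inter> ?X)) \<longlongrightarrow> \<kappa> A) H"
        by simp
    qed
  qed blast
  ultimately have "measure \<mu> A = \<kappa> A" if "A \<in> clopen_in ?X" for A using that by blast
  moreover have "cylinder u \<inter> ?X \<in> clopen_in ?X"
    unfolding clopen_in_def using open_cylinder closed_cylinder by blast
  ultimately have "c = \<kappa> (cylinder u \<inter> ?X)" by (simp add: c_def)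
  with lim have "((\<lambda>k. \<bar>F k (cylinder u \<inter> ?X) - c\<bar>) \<longlongrightarrow> \<bar>c - c\<bar>) H"
    by (intro tendsto_intros) simp
  then have "\<epsilon> \<le> \<bar>c - c\<bar>"
    by (rule tendsto_lowerbound[OF _ _ H(1)]) (simp add: F_def Nj(2))
  with \<open>0 < \<epsilon>\<close> show False by simp
qed

theorem lemma3p2:
  fixes x :: "nat \<Rightarrow> 'a::{finite, discrete_topology}"
    and \<mu> :: "(nat \<Rightarrow> 'a) measure"
  assumes "effectively_uniformly_recurrent x"
    and "uniquely_ergodic (generated_shift x)"
    and "invariant_measure (generated_shift x) \<mu>"
  shows "admits_computable_factor_frequencies x"
  using computable_frequencies_of_uniform[OF assms(1) uniform_frequencies[OF assms(2,3)]] .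

end
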